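(* Let $CP_3(n)$ be defined by $\sum_{n\ge 0} CP_3(n)q^n = \dfrac{f_3^6f_6^6}{f_1^2f_2^2}$. Then \begin{align*} \sum_{n=0}^\infty CP_3(3n)q^n &= \frac{f_2^2f_3^{18}}{f_1^6f_6^6}+2q\frac{f_3^9f_6^3}{f_1^3f_2}+28q^2\frac{f_6^{12}}{f_2^4},\\ \sum_{n=0}^\infty CP_3(3n+1)q^n &= 2\frac{f_2f_3^{15}}{f_1^5f_6^3}+13q\frac{f_3^6f_6^6}{f_1^2f_2^2}-16q^2\frac{f_1f_6^{15}}{f_2^5f_3^3},\\ \sum_{n=0}^\infty CP_3(3n+2)q^n &= 7\frac{f_3^{12}}{f_1^4}-4q\frac{f_3^3f_6^9}{f_1f_2^3}+16q^2\frac{f_1^2f_6^{18}}{f_2^6f_3^6}. \end{align*}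
   Context: For $|q|<1$ and integer $m\ge 1$, $f_m := (q^m;q^m)_\infty=\prod_{n\ge1}(1-q^{mn})$. $CP_3(n)$ is the number of $3$-core cubic bipartitions of $n$, defined by the generating function $\sum_{n\ge0}CP_3(n)q^n = \frac{f_3^6f_6^6}{f_1^2f_2^2}$. Identities are of formal power series in $q$. *)

theory Defs
  imports "HOL-Analysis.Analysis"
begin

text \<open>
  The product \<open>f m = (q^m; q^m)\<^sub>\<infinity>\<close> over \<open>n \<ge> 1\<close>, with \<open>q\<close> rendered as \<open>fps_X\<close>; the library's
  infinite product starts at \<open>0\<close>, hence the \<open>Suc n\<close>. The limit is taken in the \<open>X\<close>-adic metric on
  formal power series.
\<close>

definition qf :: "nat \<Rightarrow> rat fps" where
  "qf m = (\<Prod>n. 1 - fps_X ^ (m * Suc n))"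

text \<open>
  For \<open>m \<ge> 1\<close> the product does converge and has constant term \<open>1\<close>. In particular the power series
  quotients below have invertible denominators.
\<close>

lemma qf_partial_nth:
  assumes "k \<le> N" "m \<ge> 1"
  shows "fps_nth (\<Prod>i\<le>N. 1 - fps_X ^ (m * Suc i) :: rat fps) k =
    fps_nth (\<Prod>i\<le>k. 1 - fps_X ^ (m * Suc i)) k"
  using assms(1)
proof (induction N rule: dec_induct)
  case (step N)
  define d where "d = m * Suc (Suc N)"
  have "1 * Suc (Suc N) \<le> d"
    unfolding d_def using assms(2) by (rule mult_le_mono1)
  then have "k < d"
    using step.hyps by simp
  then have "fps_nth (A * (1 - fps_X ^ d)) k = fps_nth A k" for A :: "rat fps"
    unfolding right_diff_distrib fps_sub_nth fps_X_power_mult_right_nth by simp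
  then show ?case
    unfolding prod.atMost_Suc using step.IH by (simp only: d_def)
qed simp

lemma qf_has_prod:
  assumes "m \<ge> 1"
  shows "(\<lambda>n. 1 - fps_X ^ (m * Suc n)) has_prod qf m"
    and "fps_nth (qf m) 0 = 1"
proof -
  define P where "P = Abs_fps (\<lambda>k. fps_nth (\<Prod>i\<le>k. 1 - fps_X ^ (m * Suc i) :: rat fps) k)"
  have P0: "fps_nth P 0 = 1"
    using assms by (simp add: P_def)
  have "(\<lambda>N. \<Prod>i\<le>N. 1 - fps_X ^ (m * Suc i)) \<longlonglongrightarrow> P"
    unfolding tendsto_fps_iff
  proof
    fix k
    show "\<forall>\<^sub>F N in sequentially. fps_nth (\<Prod>i\<le>N. 1 - fps_X ^ (m * Suc i)) k = fps_nth P k"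
      using eventually_ge_at_top[of k]
      by eventually_elim (unfold P_def fps_nth_Abs_fps, erule qf_partial_nth[OF _ assms])
  qed
  moreover have "P \<noteq> 0"
    using P0 by auto
  ultimately have *: "(\<lambda>n. 1 - fps_X ^ (m * Suc n)) has_prod P"
    unfolding has_prod_def raw_has_prod_def by (simp only: add_0_right) blast
  have "qf m = P"
    using has_prod_unique[OF *] by (simp only: qf_def)
  then show "(\<lambda>n. 1 - fps_X ^ (m * Suc n)) has_prod qf m" "fps_nth (qf m) 0 = 1"
    using * P0 by simp_all
qed

text \<open>
  \<open>CP3 n\<close> is the coefficient of \<open>q^n\<close> in the generating function that defines the number of 3-core
  cubic bipartitions of \<open>n\<close>.
\<close>

definition CP3 :: "nat \<Rightarrow> rat" where
  "CP3 n = fps_nth (qf 3 ^ 6 * qf 6 ^ 6 / (qf 1 ^ 2 * qf 2 ^ 2)) n"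

end

theory Submission
  imports Defs "HOL-Computational_Algebra.Formal_Laurent_Series"
begin

text \<open>
  Write \<open>f\<^sub>1 f\<^sub>2 = \<phi>(-q) \<psi>(q)\<close> with Ramanujan's theta functions. Splitting the theta series by the residue of
  the summation index modulo 3 and applying the Jacobi triple product to the pieces gives the
  3-dissection of \<open>\<phi>(-q)\<close> and \<open>\<psi>(q)\<close>, hence
  \<open>f\<^sub>1 f\<^sub>2 = B (1 - r - 2r\<^sup>2)\<close> with \<open>B = f\<^sub>6 f\<^sub>9\<^sup>4 / (f\<^sub>3 f\<^sub>1\<^sub>8\<^sup>2)\<close> and \<open>r = q f\<^sub>3 f\<^sub>1\<^sub>8\<^sup>3 / (f\<^sub>6 f\<^sub>9\<^sup>3)\<close>.
  The norm of \<open>f\<^sub>1 f\<^sub>2\<close> over the power series in \<open>q\<^sup>3\<close> equals \<open>f\<^sub>3\<^sup>4 f\<^sub>6\<^sup>4 / (f\<^sub>9 f\<^sub>1\<^sub>8)\<close>, as can be read off the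
  product factor by factor. So \<open>1 / (f\<^sub>1 f\<^sub>2)\<close> is the product of the conjugates of \<open>f\<^sub>1 f\<^sub>2\<close>, which is
  \<open>B\<^sup>2 (1 + r + 3r\<^sup>2 - 2r\<^sup>3 + 4r\<^sup>4)\<close>, divided by this norm. Squaring it gives
  the coefficients 1, 2, 28; 2, 13, -16; 7, -4, 16 of the theorem.
\<close>

section \<open>The topology of formal power series\<close>

text \<open>Convergence of power series means that each coefficient is eventually constant. These
  instances open up the general rules for limits and infinite sums.\<close>

instance fps :: (ab_group_add) topological_comm_monoid_add
proof
  show "((\<lambda>x. fst x + snd x) \<longlongrightarrow> a + b) (nhds a \<times>\<^sub>F nhds b)" for a b :: "'a fps"
  proof (rule tendsto_fpsI)
    fix n
    have "\<forall>\<^sub>F x in nhds a \<times>\<^sub>F nhds b. fps_nth (fst x) n = fps_nth a n"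
      using filterlim_fst[of "nhds a" "nhds b"] by (simp add: tendsto_fps_iff)
    moreover have "\<forall>\<^sub>F x in nhds a \<times>\<^sub>F nhds b. fps_nth (snd x) n = fps_nth b n"
      using filterlim_snd[of "nhds b" "nhds a"] by (simp add: tendsto_fps_iff)
    ultimately show "\<forall>\<^sub>F x in nhds a \<times>\<^sub>F nhds b. fps_nth (fst x + snd x) n = fps_nth (a + b) n"
      by eventually_elim simp
  qed
qed

instance fps :: (ab_group_add) topological_ab_group_add
proof
  show "(uminus \<longlongrightarrow> - a) (nhds a)" for a :: "'a fps"
  proof (rule tendsto_fpsI)
    fix n
    have "\<forall>\<^sub>F x in nhds a. fps_nth x n = fps_nth a n"
      using filterlim_ident[of "nhds a"] by (simp add: tendsto_fps_iff)
    then show "\<forall>\<^sub>F x in nhds a. fps_nth (- x) n = fps_nth (- a) n"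
      by eventually_elim simp
  qed
qed

text \<open>Coefficient n of a product depends only on coefficients 0 to n of the factors.\<close>

instance fps :: (comm_ring_1) topological_semigroup_mult
proof
  show "((\<lambda>x. fst x * snd x) \<longlongrightarrow> a * b) (nhds a \<times>\<^sub>F nhds b)" for a b :: "'a fps"
  proof (rule tendsto_fpsI)
    fix n
    have "\<forall>\<^sub>F x in nhds a \<times>\<^sub>F nhds b. \<forall>i\<in>{..n}. fps_nth (fst x) i = fps_nth a i"
      using filterlim_fst[of "nhds a" "nhds b"] by (simp add: tendsto_fps_iff eventually_ball_finite_distrib)
    moreover have "\<forall>\<^sub>F x in nhds a \<times>\<^sub>F nhds b. \<forall>i\<in>{..n}. fps_nth (snd x) i = fps_nth b i"
      using filterlim_snd[of "nhds b" "nhds a"] by (simp add: tendsto_fps_iff eventually_ball_finite_distrib)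
    ultimately show "\<forall>\<^sub>F x in nhds a \<times>\<^sub>F nhds b. fps_nth (fst x * snd x) n = fps_nth (a * b) n"
      by eventually_elim (simp add: fps_mult_nth)
  qed
qed

instance fps :: (comm_ring_1) topological_monoid_mult ..


text \<open>A form of Tannery's theorem: a fixed coefficient sees only finitely many of the
  \<open>T i\<close>, so limits may be taken termwise while the range of summation grows.\<close>

lemma has_sum_fps_tendsto_sum:
  fixes T :: "'i \<Rightarrow> 'a :: comm_ring_1 fps"
  assumes T: "(T has_sum S) A"
    and c: "\<And>i. i \<in> A \<Longrightarrow> (\<lambda>n. c n i) \<longlonglongrightarrow> C"
    and J: "\<And>n. finite (J n)" "\<And>n. J n \<subseteq> A" "\<And>i. i \<in> A \<Longrightarrow> \<forall>\<^sub>F n in sequentially. i \<in> J n"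
  shows "(\<lambda>n. \<Sum>i\<in>J n. c n i * T i) \<longlonglongrightarrow> C * S"
proof (rule tendsto_fpsI)
  fix k
  \<comment> \<open>No multiple of a term outside \<open>B\<close> reaches coefficient k.\<close>
  define B where "B = (\<Union>l\<le>k. {i \<in> A. fps_nth (T i) l \<noteq> 0})"
  have finB: "finite B"
    unfolding B_def using has_sum_fpsD(1)[OF T] by blast
  have B: "B \<subseteq> A"
    unfolding B_def by blast
  have zero: "fps_nth (d * T i) k = 0" if "i \<in> A - B" for d i
    using that by (auto simp: B_def fps_mult_nth intro!: sum.neutral)
  have CS: "((\<lambda>i. C * T i) has_sum (C * S)) A"
    by (rule has_sum_cmult_right[OF T])
  have "fps_nth (C * S) k = (\<Sum>i\<in>B. fps_nth (C * T i) k)"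
    unfolding has_sum_fpsD(2)[OF CS]
    by (rule sum.mono_neutral_left) (use finB zero B in auto)
  then have rhs: "fps_nth (C * S) k = fps_nth (\<Sum>i\<in>B. C * T i) k"
    by (simp add: fps_sum_nth)
  have "(\<lambda>n. \<Sum>i\<in>B. c n i * T i) \<longlonglongrightarrow> (\<Sum>i\<in>B. C * T i)"
    by (intro tendsto_intros c) (use B in auto)
  then have "\<forall>\<^sub>F n in sequentially.
      fps_nth (\<Sum>i\<in>B. c n i * T i) k = fps_nth (\<Sum>i\<in>B. C * T i) k"
    by (simp add: tendsto_fps_iff)
  moreover have "\<forall>\<^sub>F n in sequentially. \<forall>i\<in>B. i \<in> J n"
    using finB B J(3) by (subst eventually_ball_finite_distrib) auto
  ultimately show "\<forall>\<^sub>F n in sequentially.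
      fps_nth (\<Sum>i\<in>J n. c n i * T i) k = fps_nth (C * S) k"
  proof eventually_elim
    case (elim n)
    have "fps_nth (\<Sum>i\<in>J n. c n i * T i) k = (\<Sum>i\<in>J n. fps_nth (c n i * T i) k)"
      by (simp add: fps_sum_nth)
    also have "\<dots> = (\<Sum>i\<in>B. fps_nth (c n i * T i) k)"
    proof (rule sum.mono_neutral_right)
      show "B \<subseteq> J n"
        using elim(2) by blast
      show "\<forall>i\<in>J n - B. fps_nth (c n i * T i) k = 0"
        using zero J(2) by blast
    qed (rule J(1))
    finally show ?case
      using elim rhs by (simp add: fps_sum_nth)
  qed
qed

section \<open>The Jacobi triple product\<close>

text \<open>Natural-valued because it serves as an exponent. It covers both exponents of the theta
  series, as \<open>triangle (- j)\<close> is j (j - 1) / 2.\<close>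

definition triangle :: "int \<Rightarrow> nat" where
  "triangle j = nat (j * (j + 1) div 2)"

lemma of_nat_triangle: "2 * int (triangle j) = j * (j + 1)"
proof -
  have "0 \<le> j * (j + 1)"
    by (cases "j \<ge> 0") (auto intro: mult_nonpos_nonpos)
  moreover have "even (j * (j + 1))"
    by simp
  ultimately show ?thesis
    unfolding triangle_def by simp
qed

text \<open>
  The terms of Ramanujan's theta function \<open>f(u, v) = \<Sum>\<^sub>j u^(j(j+1)/2) v^(j(j-1)/2)\<close>; this form of the
  Jacobi triple product avoids negative powers.
\<close>

definition theta_term :: "'a :: comm_ring_1 \<Rightarrow> 'a \<Rightarrow> int \<Rightarrow> 'a" where
  "theta_term u v j = u ^ triangle j * v ^ triangle (- j)"

lemma theta_term_uminus: "theta_term u v (- j) = theta_term v u j"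
  by (simp add: theta_term_def mult.commute)

text \<open>Consecutive terms have ratio u (u v)^(j - 1); the power of u v on each side keeps all
  exponents natural.\<close>

lemma theta_term_shift:
  assumes "j \<le> int a + 1"
  shows "u * (u * v) ^ a * theta_term u v (j - 1) = (u * v) ^ nat (int a + 1 - j) * theta_term u v j"
proof -
  have "1 + a + triangle (j - 1) = nat (int a + 1 - j) + triangle j"
    using of_nat_triangle[of j] of_nat_triangle[of "j - 1"] assms
    by (simp add: algebra_simps flip: of_nat_eq_iff)
  moreover have "a + triangle (- (j - 1)) = nat (int a + 1 - j) + triangle (- j)"
    using of_nat_triangle[of "- j"] of_nat_triangle[of "- (j - 1)"] assms
    by (simp add: algebra_simps flip: of_nat_eq_iff)
  ultimately have
    "u ^ (1 + a + triangle (j - 1)) * v ^ (a + triangle (- (j - 1))) =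
     u ^ (nat (int a + 1 - j) + triangle j) * v ^ (nat (int a + 1 - j) + triangle (- j))"
    by simp
  then show ?thesis
    by (simp add: theta_term_def power_add power_mult_distrib mult_ac)
qed

lemma theta_term_nonneg:
  assumes "j \<ge> 0"
  shows "theta_term u v j = (u * v) ^ triangle (- j) * u ^ nat j"
proof -
  have "triangle j = triangle (- j) + nat j"
    using of_nat_triangle[of j] of_nat_triangle[of "- j"] assms
    by (simp add: algebra_simps flip: of_nat_eq_iff)
  then show ?thesis
    by (simp add: theta_term_def power_add power_mult_distrib mult_ac)
qed

lemma finite_theta_term_support:
  fixes u v :: "'a :: comm_ring_1 fps"
  assumes "fps_nth (u * v) 0 = 0"
  shows "finite {j. fps_nth (theta_term u v j) n \<noteq> 0}"
proof -
  have zero: "fps_nth (theta_term u v j) n = 0"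
    if "j > int n + 1" "fps_nth (u * v) 0 = 0" for j and u v :: "'a fps"
  proof -
    \<comment> \<open>Equivalently j (j - 1) / 2 >= j - 1, and j - 1 exceeds n.\<close>
    have "(j - 2) * (j - 1) \<ge> 0"
      using that by simp
    then have "triangle (- j) > n"
      using of_nat_triangle[of "- j"] that by (simp add: algebra_simps)
    then have "\<forall>i\<le>n. fps_nth ((u * v) ^ triangle (- j)) i = 0"
      using startsby_zero_power_prefix[OF that(2)] by simp
    then show ?thesis
      using that by (simp add: theta_term_nonneg fps_mult_nth)
  qed
  have "{j. fps_nth (theta_term u v j) n \<noteq> 0} \<subseteq> {- (int n + 1)..int n + 1}"
    using zero[of _ u v] zero[of "- _" v u] assms
    by (force simp: theta_term_uminus mult.commute)
  then show ?thesis
    by (rule finite_subset) simp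
qed

definition theta :: "'a :: comm_ring_1 fps \<Rightarrow> 'a fps \<Rightarrow> 'a fps" where
  "theta u v = Abs_fps (\<lambda>n. \<Sum>j | fps_nth (theta_term u v j) n \<noteq> 0. fps_nth (theta_term u v j) n)"

lemma has_sum_theta:
  assumes "fps_nth (u * v) 0 = 0"
  shows "(theta_term u v has_sum theta u v) UNIV"
  by (rule has_sum_fpsI) (use finite_theta_term_support[OF assms] in \<open>simp_all add: theta_def\<close>)

lemma theta_commute: "theta u v = theta v u"
proof -
  have "(\<Sum>j | fps_nth (theta_term u v j) n \<noteq> 0. fps_nth (theta_term u v j) n) =
        (\<Sum>j | fps_nth (theta_term v u j) n \<noteq> 0. fps_nth (theta_term v u j) n)" for n
    by (rule sum.reindex_bij_witness[of _ uminus uminus]) (auto simp: theta_term_uminus)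
  then show ?thesis
    by (simp add: theta_def)
qed

section \<open>The finite triple product\<close>

text \<open>
  Up to the factor \<open>(p; p)\<^sub>a\<^sub>+\<^sub>b\<close>, the coefficients of \<open>theta_partial\<close> below are Gaussian binomials.
  Setting \<open>1 / (p; p)\<^sub>k = 0\<close> for \<open>k < 0\<close> makes their Pascal rule hold at the boundary as well.
\<close>

definition pochhammer_recip :: "'a :: field fps \<Rightarrow> int \<Rightarrow> 'a fps" where
  "pochhammer_recip p k = (if k < 0 then 0 else inverse (\<Prod>i<nat k. 1 - p ^ Suc i))"

lemma fps_nth_0_prod_one_minus [simp]:
  assumes "fps_nth p 0 = 0"
  shows "fps_nth (\<Prod>i<n. 1 - p ^ Suc i :: 'a :: field fps) 0 = 1"
  using assms by (induction n) (simp_all add: fps_nth_power_0)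

text \<open>For k > 0 one factor cancels. At k = 0 the factor 1 - p^0 vanishes, in agreement with
  the default value at -1.\<close>

lemma pochhammer_recip_pred:
  fixes p :: "'a :: field fps"
  assumes p: "fps_nth p 0 = 0"
  shows "pochhammer_recip p (k - 1) = (1 - p ^ nat k) * pochhammer_recip p k"
proof (cases "k \<le> 0")
  case True
  then show ?thesis
    by (cases "k = 0") (simp_all add: pochhammer_recip_def)
next
  case False
  define n where "n = nat (k - 1)"
  have k: "nat k = Suc n" "nat (k - 1) = n" "\<not> k < 0" "\<not> k - 1 < 0"
    using False by (simp_all add: n_def)
  have "fps_nth (1 - p ^ Suc n) 0 \<noteq> 0"
    using p by (simp add: fps_nth_power_0)
  then have "(1 - p ^ Suc n) * inverse (1 - p ^ Suc n) = 1"
    by (rule inverse_mult_eq_1')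
  moreover have "pochhammer_recip p (k - 1) = inverse (\<Prod>i<n. 1 - p ^ Suc i)"
    and "pochhammer_recip p k = inverse (\<Prod>i<n. 1 - p ^ Suc i) * inverse (1 - p ^ Suc n)"
    using k by (simp_all add: pochhammer_recip_def fps_inverse_mult)
  ultimately show ?thesis
    unfolding k by (simp only: mult.left_commute[of "1 - p ^ Suc n"] mult_1_right)
qed

definition theta_partial :: "'a :: field fps \<Rightarrow> 'a fps \<Rightarrow> nat \<Rightarrow> nat \<Rightarrow> 'a fps" where
  "theta_partial u v a b =
    (\<Sum>j = - int b..int a. pochhammer_recip (u * v) (int b + j) * pochhammer_recip (u * v) (int a - j)
       * theta_term u v j)"

lemma theta_partial_commute: "theta_partial u v a b = theta_partial v u b a"
  unfolding theta_partial_def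
  by (rule sum.reindex_bij_witness[of _ uminus uminus])
     (auto simp: theta_term_uminus[of v u] mult.commute)

text \<open>The q-Pascal rule, summed over j: raising the upper end of the range absorbs one factor
  of the product.\<close>

lemma theta_partial_Suc:
  fixes u v :: "'a :: field fps"
  assumes p: "fps_nth (u * v) 0 = 0"
  shows "(1 + u * (u * v) ^ a) * theta_partial u v a b =
    (1 - (u * v) ^ Suc (a + b)) * theta_partial u v (Suc a) b"
proof -
  define p where "p = u * v"
  let ?r = "pochhammer_recip p" and ?T = "theta_term u v"
  let ?I = "{- int b..int a + 1}"
  \<comment> \<open>The added index j = a + 1 contributes 0, since \<open>?r (- 1)\<close> is
    0.\<close>
  have "theta_partial u v a b = (\<Sum>j\<in>?I. ?r (int b + j) * ?r (int a - j) * ?T j)"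
    unfolding theta_partial_def p_def[symmetric]
    by (rule sum.mono_neutral_left) (auto simp: pochhammer_recip_def)
  moreover have "u * p ^ a * theta_partial u v a b =
      (\<Sum>j\<in>?I. ?r (int b + j - 1) * ?r (int a + 1 - j) * p ^ nat (int a + 1 - j) * ?T j)"
  proof -
    have "u * p ^ a * theta_partial u v a b =
        (\<Sum>j = - int b..int a. ?r (int b + j) * ?r (int a - j) * (u * p ^ a * ?T j))"
      unfolding theta_partial_def p_def[symmetric] sum_distrib_left
      by (rule sum.cong) (simp_all add: algebra_simps)
    also have "\<dots> = (\<Sum>j = - int b + 1..int a + 1.
        ?r (int b + j - 1) * ?r (int a + 1 - j) * (u * p ^ a * ?T (j - 1)))"
      by (rule sum.reindex_bij_witness[of _ "\<lambda>j. j - 1" "\<lambda>j. j + 1"]) (auto simp: algebra_simps)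
    \<comment> \<open>Here the added index is j = - b, again with a factor
      \<open>?r (- 1)\<close>.\<close>
    also have "\<dots> = (\<Sum>j\<in>?I. ?r (int b + j - 1) * ?r (int a + 1 - j) * (u * p ^ a * ?T (j - 1)))"
      by (rule sum.mono_neutral_left) (auto simp: pochhammer_recip_def)
    also have "\<dots> = (\<Sum>j\<in>?I.
        ?r (int b + j - 1) * ?r (int a + 1 - j) * p ^ nat (int a + 1 - j) * ?T j)"
    proof (rule sum.cong)
      fix j assume "j \<in> ?I"
      then have "u * p ^ a * ?T (j - 1) = p ^ nat (int a + 1 - j) * ?T j"
        unfolding p_def by (intro theta_term_shift) simp
      then show "?r (int b + j - 1) * ?r (int a + 1 - j) * (u * p ^ a * ?T (j - 1)) =
          ?r (int b + j - 1) * ?r (int a + 1 - j) * p ^ nat (int a + 1 - j) * ?T j"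
        by (simp only: mult.assoc)
    qed simp
    finally show ?thesis .
  qed
  ultimately have "(1 + u * p ^ a) * theta_partial u v a b = (\<Sum>j\<in>?I.
      ?r (int b + j) * ?r (int a - j) * ?T j +
      ?r (int b + j - 1) * ?r (int a + 1 - j) * p ^ nat (int a + 1 - j) * ?T j)"
    unfolding distrib_right sum.distrib by simp
  also have "\<dots> = (\<Sum>j\<in>?I. (1 - p ^ Suc (a + b)) *
      (?r (int b + j) * ?r (int a + 1 - j) * ?T j))"
  proof (rule sum.cong)
    fix j assume j: "j \<in> ?I"
    have 1: "?r (int a - j) = (1 - p ^ nat (int a + 1 - j)) * ?r (int a + 1 - j)"
      using pochhammer_recip_pred[OF p, of "int a + 1 - j"] by (simp add: p_def)
    have 2: "?r (int b + j - 1) = (1 - p ^ nat (int b + j)) * ?r (int b + j)"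
      using pochhammer_recip_pred[OF p, of "int b + j"] by (simp add: p_def)
    \<comment> \<open>With A = p^(a + 1 - j) and B = p^(b + j), the two summands combine by (1 - A)
      + A (1 - B) = 1 - A B.\<close>
    have "Suc (a + b) = nat (int a + 1 - j) + nat (int b + j)"
      using j by auto
    then have 3: "p ^ Suc (a + b) = p ^ nat (int a + 1 - j) * p ^ nat (int b + j)"
      by (simp add: power_add)
    show "?r (int b + j) * ?r (int a - j) * ?T j +
        ?r (int b + j - 1) * ?r (int a + 1 - j) * p ^ nat (int a + 1 - j) * ?T j =
        (1 - p ^ Suc (a + b)) * (?r (int b + j) * ?r (int a + 1 - j) * ?T j)"
      unfolding 1 2 3 by (simp add: algebra_simps)
  qed simp
  also have "\<dots> = (1 - p ^ Suc (a + b)) * theta_partial u v (Suc a) b"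
    unfolding theta_partial_def p_def[symmetric] sum_distrib_left[symmetric]
    by (simp add: algebra_simps)
  finally show ?thesis
    by (simp add: p_def)
qed

text \<open>Each induction step raises a and then b by one, which accounts for 1 - p^(2n+1) and 1 -
  p^(2n+2), where p = u v.\<close>

lemma finite_triple_product:
  fixes u v :: "'a :: field fps"
  assumes p: "fps_nth (u * v) 0 = 0"
  shows "(\<Prod>i<n. (1 + u * (u * v) ^ i) * (1 + v * (u * v) ^ i)) =
    (\<Prod>i<2 * n. 1 - (u * v) ^ Suc i) * theta_partial u v n n"
proof (induction n)
  case 0
  show ?case
    by (simp add: theta_partial_def theta_term_def pochhammer_recip_def triangle_def)
next
  case (Suc n)
  define p where "p = u * v"
  have u: "(1 + u * p ^ n) * theta_partial u v n n = (1 - p ^ Suc (2 * n)) * theta_partial u v (Suc n) n"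
    using theta_partial_Suc[OF p, of n n] by (simp add: p_def mult_2)
  \<comment> \<open>The same recurrence with u and v exchanged, which exchanges a and b.\<close>
  have v: "(1 + v * p ^ n) * theta_partial u v (Suc n) n =
      (1 - p ^ Suc (Suc (2 * n))) * theta_partial u v (Suc n) (Suc n)"
    using theta_partial_Suc[of v u n "Suc n"] p
    by (simp add: p_def mult_2 theta_partial_commute[of u v] mult.commute[of v u])
  have "(\<Prod>i<Suc n. (1 + u * p ^ i) * (1 + v * p ^ i)) =
      (\<Prod>i<2 * n. 1 - p ^ Suc i) * ((1 + v * p ^ n) * ((1 + u * p ^ n) * theta_partial u v n n))"
    using Suc.IH by (simp add: p_def mult_ac)
  also have "\<dots> = (\<Prod>i<2 * n. 1 - p ^ Suc i) * ((1 - p ^ Suc (2 * n)) *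
      ((1 + v * p ^ n) * theta_partial u v (Suc n) n))"
    unfolding u by (simp only: mult.left_commute)
  also have "\<dots> = (\<Prod>i<2 * Suc n. 1 - p ^ Suc i) * theta_partial u v (Suc n) (Suc n)"
    unfolding v by (simp only: mult_Suc_right add_2_eq_Suc prod.lessThan_Suc mult.assoc)
  finally show ?case
    by (simp only: p_def)
qed

section \<open>The infinite triple product\<close>

text \<open>In the finite identity the prefactor tends to C and each reciprocal to 1 / C, so W is
  theta divided by C. The limit W is a parameter, to be instantiated by eta quotients.\<close>

theorem jacobi_triple_product:
  fixes u v :: "'a :: field fps"
  assumes p: "fps_nth (u * v) 0 = 0"
    and W: "(\<lambda>n. \<Prod>i<n. (1 + u * (u * v) ^ i) * (1 + v * (u * v) ^ i)) \<longlonglongrightarrow> W"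
    and C: "(\<lambda>n. \<Prod>i<n. 1 - (u * v) ^ Suc i) \<longlonglongrightarrow> C"
  shows "theta u v = W * C"
proof -
  define p where "p = u * v"
  have C0: "fps_nth C 0 = 1"
  proof -
    have "\<forall>\<^sub>F n in sequentially. fps_nth (\<Prod>i<n. 1 - (u * v) ^ Suc i) 0 = fps_nth C 0"
      using C by (simp add: tendsto_fps_iff)
    then have "\<forall>\<^sub>F n :: nat in sequentially. 1 = fps_nth C 0"
      by eventually_elim (use fps_nth_0_prod_one_minus[OF p] in simp)
    then show ?thesis
      by simp
  qed
  \<comment> \<open>The shift k stands for j or - j; once n >= - k, the default value 0 no longer
    occurs.\<close>
  have r: "(\<lambda>n. pochhammer_recip p (int n + k)) \<longlonglongrightarrow> inverse C" for k
  proof (rule Lim_transform_eventually)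
    have "filterlim (\<lambda>n. nat (int n + k)) sequentially sequentially"
      unfolding filterlim_at_top
    proof
      fix Z
      show "\<forall>\<^sub>F n in sequentially. Z \<le> nat (int n + k)"
        using eventually_ge_at_top[of "Z + nat (- k)"] by eventually_elim linarith
    qed
    from filterlim_compose[OF C this] C0
    show "(\<lambda>n. inverse (\<Prod>i<nat (int n + k). 1 - (u * v) ^ Suc i)) \<longlonglongrightarrow> inverse C"
      by (intro tendsto_inverse_fps) auto
    show "\<forall>\<^sub>F n in sequentially.
        inverse (\<Prod>i<nat (int n + k). 1 - (u * v) ^ Suc i) = pochhammer_recip p (int n + k)"
      using eventually_ge_at_top[of "nat (- k)"]
      by eventually_elim (auto simp: pochhammer_recip_def p_def)
  qed
  have "(\<lambda>n. theta_partial u v n n) \<longlonglongrightarrow> inverse C * inverse C * theta u v"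
    unfolding theta_partial_def p_def[symmetric]
  proof (rule has_sum_fps_tendsto_sum[OF has_sum_theta[OF p]])
    show "(\<lambda>n. pochhammer_recip p (int n + j) * pochhammer_recip p (int n - j))
        \<longlonglongrightarrow> inverse C * inverse C" for j
      using tendsto_mult[OF r[of j] r[of "- j"]] by simp
    show "\<forall>\<^sub>F n in sequentially. j \<in> {- int n..int n}" for j
      using eventually_ge_at_top[of "nat \<bar>j\<bar>"] by eventually_elim auto
  qed simp_all
  moreover have "filterlim (\<lambda>n :: nat. 2 * n) sequentially sequentially"
    by (rule filterlim_subseq) (simp add: strict_mono_def)
  from filterlim_compose[OF C this] have "(\<lambda>n. \<Prod>i<2 * n. 1 - (u * v) ^ Suc i) \<longlonglongrightarrow> C" .
  ultimately have "(\<lambda>n. (\<Prod>i<2 * n. 1 - (u * v) ^ Suc i) * theta_partial u v n n)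
      \<longlonglongrightarrow> C * (inverse C * inverse C * theta u v)"
    by (intro tendsto_mult)
  then have "W = C * (inverse C * inverse C * theta u v)"
    using W unfolding finite_triple_product[OF p] by (intro LIMSEQ_unique)
  also have "\<dots> * C = (C * inverse C) * (C * inverse C) * theta u v"
    by (simp add: mult_ac)
  also have "C * inverse C = 1"
    using C0 by (intro inverse_mult_eq_1') simp
  finally show ?thesis
    by simp
qed

section \<open>Theta functions as eta quotients\<close>

definition qf_partial :: "nat \<Rightarrow> nat \<Rightarrow> rat fps" where
  "qf_partial m n = (\<Prod>i<n. 1 - fps_X ^ (m * Suc i))"

lemma qf_partial_0 [simp]: "qf_partial m 0 = 1"
  by (simp add: qf_partial_def)

lemma qf_partial_Suc: "qf_partial m (Suc n) = qf_partial m n * (1 - fps_X ^ (m * Suc n))"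
  by (simp add: qf_partial_def)

lemma qf_partial_add:
  "qf_partial m (a + k) = qf_partial m a * (\<Prod>i<k. 1 - fps_X ^ (m * Suc i) * fps_X ^ (m * a))"
proof (induction k)
  case (Suc k)
  have "m * Suc (a + k) = m * Suc k + m * a"
    by (simp add: algebra_simps)
  then show ?case
    by (simp add: qf_partial_Suc Suc.IH power_add mult.assoc del: mult_Suc_right)
qed simp

lemma qf_partial_mult_Suc:
  "qf_partial m (k * Suc n) =
    qf_partial m (k * n) * (\<Prod>i<k. 1 - fps_X ^ (m * Suc i) * fps_X ^ (m * (k * n)))"
  using qf_partial_add[of m "k * n" k] by (simp add: add.commute)

lemma qf_nz [simp]: "m \<ge> 1 \<Longrightarrow> qf m \<noteq> 0"
  using qf_has_prod(2)[of m] by auto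

text \<open>Subsequences \<open>k * n\<close> occur because products with different moduli are
  truncated at matching lengths.\<close>

lemma qf_partial_tendsto:
  assumes "m \<ge> 1" "k \<ge> 1"
  shows "(\<lambda>n. qf_partial m (k * n)) \<longlonglongrightarrow> qf m"
proof -
  have "(\<lambda>n. \<Prod>i\<le>n. 1 - fps_X ^ (m * Suc i)) \<longlonglongrightarrow> qf m"
    using qf_has_prod(1)[OF assms(1)] qf_nz[OF assms(1)] by (auto simp: has_prod_def raw_has_prod_def)
  then have "(\<lambda>n. qf_partial m (Suc n)) \<longlonglongrightarrow> qf m"
    by (simp only: qf_partial_def lessThan_Suc_atMost)
  then have "qf_partial m \<longlonglongrightarrow> qf m"
    by (rule LIMSEQ_imp_Suc)
  moreover have "filterlim (\<lambda>n. k * n) sequentially sequentially"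
    by (rule filterlim_subseq) (use assms in \<open>simp add: strict_mono_def\<close>)
  ultimately show ?thesis
    by (rule filterlim_compose)
qed

text \<open>Convergence of W is a conclusion: W = E / D as soon as the constant term of D has
  stabilized.\<close>

lemma fps_tendsto_divide_unit:
  fixes d :: "'a :: field fps"
  assumes "\<And>n. W n * D n = E n" and D: "(D \<longlongrightarrow> d) F" and E: "(E \<longlongrightarrow> e) F" and d: "fps_nth d 0 \<noteq> 0"
  shows "(W \<longlongrightarrow> e * inverse d) F"
proof (rule Lim_transform_eventually)
  show "((\<lambda>n. E n * inverse (D n)) \<longlongrightarrow> e * inverse d) F"
    by (intro tendsto_intros D E d)
  have "\<forall>\<^sub>F n in F. fps_nth (D n) 0 = fps_nth d 0"
    using D by (simp add: tendsto_fps_iff)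
  then show "\<forall>\<^sub>F n in F. E n * inverse (D n) = W n"
  proof eventually_elim
    case (elim n)
    then have "D n * inverse (D n) = 1"
      using d by (intro inverse_mult_eq_1') simp
    then show ?case
      by (simp add: assms(1)[symmetric] mult.assoc)
  qed
qed

text \<open>Reduces the evaluation of a theta function to an identity of finite products, which
  induction can prove.\<close>

lemma theta_eq_qf_quotient:
  assumes uv: "u * v = fps_X ^ m" and m: "m \<ge> 1"
    and "\<And>n. (\<Prod>i<n. (1 + u * fps_X ^ (m * i)) * (1 + v * fps_X ^ (m * i))) * D n = E n"
    and "D \<longlonglongrightarrow> d" "E \<longlonglongrightarrow> e" "fps_nth d 0 \<noteq> 0"
  shows "theta u v = e * inverse d * qf m"
proof (rule jacobi_triple_product)
  show "fps_nth (u * v) 0 = 0"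
    using m by (simp add: uv)
  show "(\<lambda>n. \<Prod>i<n. (1 + u * (u * v) ^ i) * (1 + v * (u * v) ^ i)) \<longlonglongrightarrow> e * inverse d"
    unfolding uv power_mult[symmetric] by (rule fps_tendsto_divide_unit) fact+
  show "(\<lambda>n. \<Prod>i<n. 1 - (u * v) ^ Suc i) \<longlonglongrightarrow> qf m"
    unfolding uv power_mult[symmetric] using qf_partial_tendsto[OF m, of 1] by (simp add: qf_partial_def)
qed

section \<open>Product formulas for four theta functions\<close>

text \<open>This is phi(-q) = f_1^2 / f_2: the odd factors of f_1 are all factors divided by the
  even ones.\<close>

lemma theta_X_X: "theta (- fps_X) (- fps_X) = qf 1 ^ 2 * inverse (qf 2 ^ 2) * qf 2"
proof (rule theta_eq_qf_quotient)
  show "(\<Prod>i<n. (1 + - fps_X * fps_X ^ (2 * i)) * (1 + - fps_X * fps_X ^ (2 * i))) *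
    qf_partial 2 (1 * n) ^ 2 = qf_partial 1 (2 * n) ^ 2" for n
  proof (induction n)
    case (Suc n)
    have 1: "qf_partial 1 (2 * Suc n) =
        qf_partial 1 (2 * n) * (1 - fps_X * fps_X ^ (2 * n)) * (1 - fps_X ^ (2 * Suc n))"
      by (simp add: qf_partial_Suc)
    show ?case
      unfolding 1 power_mult_distrib Suc.IH[symmetric]
      by (simp add: qf_partial_Suc power_mult_distrib power2_eq_square mult_ac)
  qed simp
  show "(\<lambda>n. qf_partial 2 (1 * n) ^ 2) \<longlonglongrightarrow> qf 2 ^ 2"
    and "(\<lambda>n. qf_partial 1 (2 * n) ^ 2) \<longlonglongrightarrow> qf 1 ^ 2"
    by (intro tendsto_intros qf_partial_tendsto; simp)+
qed (auto simp: qf_has_prod(2) power2_eq_square)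

text \<open>This is 2 psi(q): the exponents at j and 1 - j agree, so every triangular number is
  counted twice.\<close>

lemma theta_1_X: "theta 1 fps_X = 2 * qf 2 ^ 2 * inverse (qf 1 ^ 2) * qf 1"
proof (rule theta_eq_qf_quotient)
  \<comment> \<open>The first product starts with 1 + X^0 = 2 and stops before 1 + X^n. The latter
    is supplied as a correction that tends to 1.\<close>
  show "(\<Prod>i<n. (1 + 1 * fps_X ^ (1 * i)) * (1 + fps_X * fps_X ^ (1 * i))) *
    ((1 + fps_X ^ n) * qf_partial 1 (1 * n) ^ 2) = 2 * qf_partial 2 (1 * n) ^ 2" for n
  proof (induction n)
    case (Suc n)
    have "1 - fps_X ^ (2 * Suc n) = (1 - fps_X ^ Suc n) * (1 + fps_X ^ Suc n :: rat fps)"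
      unfolding power_mult mult.commute[of 2] by (simp add: algebra_simps power2_eq_square)
    then have 1: "qf_partial 2 (Suc n) = qf_partial 2 n * (1 - fps_X ^ Suc n) * (1 + fps_X ^ Suc n)"
      by (simp add: qf_partial_Suc)
    have 2: "qf_partial 1 (Suc n) = qf_partial 1 n * (1 - fps_X ^ Suc n)"
      by (simp add: qf_partial_Suc)
    have "2 * qf_partial 2 (Suc n) ^ 2 =
        (2 * qf_partial 2 (1 * n) ^ 2) * (1 - fps_X ^ Suc n) ^ 2 * (1 + fps_X ^ Suc n) ^ 2"
      by (simp only: 1 power_mult_distrib mult_1_left mult.assoc)
    then show ?case
      unfolding Suc.IH[symmetric]
      unfolding mult_1_left 2 prod.lessThan_Suc power2_eq_square power_Suc by (simp only: mult_ac)
  qed simp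
  have "(\<lambda>n. fps_X ^ n :: rat fps) \<longlonglongrightarrow> 0"
  proof (rule tendsto_fpsI)
    show "\<forall>\<^sub>F n in sequentially. fps_nth (fps_X ^ n :: rat fps) k = fps_nth 0 k" for k
      using eventually_gt_at_top[of k] by eventually_elim simp
  qed
  then have "(\<lambda>n. (1 + fps_X ^ n) * qf_partial 1 (1 * n) ^ 2) \<longlonglongrightarrow> (1 + 0) * qf 1 ^ 2"
    by (intro tendsto_intros qf_partial_tendsto) simp_all
  then show "(\<lambda>n. (1 + fps_X ^ n) * qf_partial 1 (1 * n) ^ 2) \<longlonglongrightarrow> qf 1 ^ 2"
    by simp
  show "(\<lambda>n. 2 * qf_partial 2 (1 * n) ^ 2) \<longlonglongrightarrow> 2 * qf 2 ^ 2"
    by (intro tendsto_intros qf_partial_tendsto) simp_all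
qed (auto simp: qf_has_prod(2))

lemma prod_lessThan_numeral:
  fixes f :: "nat \<Rightarrow> 'a :: comm_monoid_mult"
  shows "(\<Prod>i<1. f i) = f 0"
    and "(\<Prod>i<2. f i) = f 0 * f 1"
    and "(\<Prod>i<3. f i) = f 0 * f 1 * f 2"
    and "(\<Prod>i<6. f i) = f 0 * f 1 * f 2 * f 3 * f 4 * f 5"
  by (simp_all add: lessThan_nat_numeral lessThan_Suc mult_ac)

text \<open>Exponents congruent to 1 or 5 modulo 6 are those prime to 6: divide f_1 by f_2 and f_3,
  and restore f_6. The last \<open>qf 6\<close> comes from the triple product.\<close>

lemma theta_X_X5: "theta (- fps_X) (- (fps_X ^ 5)) = qf 1 * qf 6 * inverse (qf 2 * qf 3) * qf 6"
proof (rule theta_eq_qf_quotient)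
  show "(\<Prod>i<n. (1 + - fps_X * fps_X ^ (6 * i)) * (1 + - (fps_X ^ 5) * fps_X ^ (6 * i))) *
    (qf_partial 2 (3 * n) * qf_partial 3 (2 * n)) = qf_partial 1 (6 * n) * qf_partial 6 (1 * n)" for n
  proof (induction n)
    case (Suc n)
    define y :: "rat fps" where "y = fps_X ^ (6 * n)"
    have 1: "qf_partial 1 (6 * Suc n) = qf_partial 1 (6 * n) * ((1 - fps_X * y) * (1 - fps_X ^ 2 * y) *
        (1 - fps_X ^ 3 * y) * (1 - fps_X ^ 4 * y) * (1 - fps_X ^ 5 * y) * (1 - fps_X ^ 6 * y))"
      unfolding qf_partial_mult_Suc prod_lessThan_numeral y_def by (simp add: power2_eq_square)
    have 2: "qf_partial 2 (3 * Suc n) = qf_partial 2 (3 * n) * ((1 - fps_X ^ 2 * y) *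
        (1 - fps_X ^ 4 * y) * (1 - fps_X ^ 6 * y))"
      unfolding qf_partial_mult_Suc prod_lessThan_numeral y_def by simp
    have 3: "qf_partial 3 (2 * Suc n) = qf_partial 3 (2 * n) * ((1 - fps_X ^ 3 * y) * (1 - fps_X ^ 6 * y))"
      unfolding qf_partial_mult_Suc prod_lessThan_numeral y_def by simp
    have 6: "qf_partial 6 (1 * Suc n) = qf_partial 6 (1 * n) * (1 - fps_X ^ 6 * y)"
      unfolding qf_partial_mult_Suc prod_lessThan_numeral y_def by simp
    have "qf_partial 1 (6 * Suc n) * qf_partial 6 (1 * Suc n) =
        (qf_partial 1 (6 * n) * qf_partial 6 (1 * n)) * ((1 - fps_X * y) * (1 - fps_X ^ 2 * y) *
        (1 - fps_X ^ 3 * y) * (1 - fps_X ^ 4 * y) * (1 - fps_X ^ 5 * y) * (1 - fps_X ^ 6 * y) * (1 - fps_X ^ 6 * y))"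
      unfolding 1 6 by (simp only: mult_ac)
    also have "\<dots> = (\<Prod>i<Suc n. (1 + - fps_X * fps_X ^ (6 * i)) * (1 + - (fps_X ^ 5) * fps_X ^ (6 * i))) *
        (qf_partial 2 (3 * Suc n) * qf_partial 3 (2 * Suc n))"
      unfolding 2 3 Suc.IH[symmetric] prod.lessThan_Suc y_def[symmetric] by (simp add: mult_ac)
    finally show ?case ..
  qed simp
  show "(\<lambda>n. qf_partial 2 (3 * n) * qf_partial 3 (2 * n)) \<longlonglongrightarrow> qf 2 * qf 3"
    and "(\<lambda>n. qf_partial 1 (6 * n) * qf_partial 6 (1 * n)) \<longlonglongrightarrow> qf 1 * qf 6"
    by (intro tendsto_intros qf_partial_tendsto; simp)+
qed (auto simp: qf_has_prod(2) eval_nat_numeral)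

text \<open>Write 1 + x = (1 - x^2) / (1 - x) for x = q^k with k not divisible by 3.\<close>

lemma theta_X_X2: "theta fps_X (fps_X ^ 2) = qf 2 * qf 3 * inverse (qf 1 * qf 6) * qf 3"
proof (rule theta_eq_qf_quotient)
  show "(\<Prod>i<n. (1 + fps_X * fps_X ^ (3 * i)) * (1 + fps_X ^ 2 * fps_X ^ (3 * i))) *
    (qf_partial 1 (3 * n) * qf_partial 6 (1 * n)) = qf_partial 2 (3 * n) * qf_partial 3 (1 * n)" for n
  proof (induction n)
    case (Suc n)
    define y :: "rat fps" where "y = fps_X ^ (3 * n)"
    have 1: "qf_partial 1 (3 * Suc n) = qf_partial 1 (3 * n) * ((1 - fps_X * y) * (1 - fps_X ^ 2 * y) *
        (1 - fps_X ^ 3 * y))"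
      unfolding qf_partial_mult_Suc prod_lessThan_numeral y_def by (simp add: power2_eq_square)
    have y2: "fps_X ^ (6 * n) = y * y"
      by (simp add: y_def flip: power_add)
    have 2: "qf_partial 2 (3 * Suc n) = qf_partial 2 (3 * n) * ((1 - fps_X ^ 2 * (y * y)) *
        (1 - fps_X ^ 4 * (y * y)) * (1 - fps_X ^ 6 * (y * y)))"
      unfolding qf_partial_mult_Suc prod_lessThan_numeral y2[symmetric] by simp
    have 3: "qf_partial 3 (1 * Suc n) = qf_partial 3 (1 * n) * (1 - fps_X ^ 3 * y)"
      unfolding qf_partial_mult_Suc prod_lessThan_numeral y_def by simp
    have 6: "qf_partial 6 (1 * Suc n) = qf_partial 6 (1 * n) * (1 - fps_X ^ 6 * (y * y))"
      unfolding qf_partial_mult_Suc prod_lessThan_numeral y2[symmetric] by simp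
    have "1 - fps_X ^ 2 * (y * y) = (1 - fps_X * y) * (1 + fps_X * y)"
      and "1 - fps_X ^ 4 * (y * y) = (1 - fps_X ^ 2 * y) * (1 + fps_X ^ 2 * y)"
      by (simp_all add: algebra_simps eval_nat_numeral)
    then have "qf_partial 2 (3 * Suc n) * qf_partial 3 (1 * Suc n) =
        (qf_partial 2 (3 * n) * qf_partial 3 (1 * n)) * ((1 - fps_X * y) * (1 + fps_X * y) *
        (1 - fps_X ^ 2 * y) * (1 + fps_X ^ 2 * y) * (1 - fps_X ^ 6 * (y * y)) * (1 - fps_X ^ 3 * y))"
      unfolding 2 3 by (simp only: mult_ac)
    also have "\<dots> = (\<Prod>i<Suc n. (1 + fps_X * fps_X ^ (3 * i)) * (1 + fps_X ^ 2 * fps_X ^ (3 * i))) *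
        (qf_partial 1 (3 * Suc n) * qf_partial 6 (1 * Suc n))"
      unfolding 1 6 Suc.IH[symmetric] prod.lessThan_Suc y_def[symmetric] by (simp only: mult_ac)
    finally show ?case ..
  qed simp
  show "(\<lambda>n. qf_partial 1 (3 * n) * qf_partial 6 (1 * n)) \<longlonglongrightarrow> qf 1 * qf 6"
    and "(\<lambda>n. qf_partial 2 (3 * n) * qf_partial 3 (1 * n)) \<longlonglongrightarrow> qf 2 * qf 3"
    by (intro tendsto_intros qf_partial_tendsto; simp)+
qed (auto simp: qf_has_prod(2) eval_nat_numeral)

section \<open>Dissection modulo 3\<close>

definition dilate3 :: "'a :: comm_ring_1 fps \<Rightarrow> 'a fps" where
  "dilate3 F = F oo fps_X ^ 3"

definition section3 :: "nat \<Rightarrow> 'a :: comm_ring_1 fps \<Rightarrow> 'a fps" where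
  "section3 r F = Abs_fps (\<lambda>n. fps_nth F (3 * n + r))"

lemma nth_dilate3: "fps_nth (dilate3 F) n = (if 3 dvd n then fps_nth F (n div 3) else 0)"
proof -
  have "fps_nth (dilate3 F) n = (\<Sum>i = 0..n. fps_nth F i * fps_nth (fps_X ^ (3 * i)) n)"
    unfolding dilate3_def fps_compose_nth by (simp add: power_mult)
  also have "\<dots> = (\<Sum>i\<in>(if 3 dvd n then {n div 3} else {}). fps_nth F i * fps_nth (fps_X ^ (3 * i)) n)"
    by (intro sum.mono_neutral_right) auto
  finally show ?thesis
    by auto
qed

lemma dilate3_simps [simp]:
  fixes F G :: "'a :: idom fps"
  shows "dilate3 0 = (0 :: 'a fps)" "dilate3 1 = (1 :: 'a fps)"
    and "dilate3 (F + G) = dilate3 F + dilate3 G"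
    and "dilate3 (F - G) = dilate3 F - dilate3 G"
    and "dilate3 (- F) = - dilate3 F"
    and "dilate3 (F * G) = dilate3 F * dilate3 G"
    and "dilate3 (F ^ k) = dilate3 F ^ k"
    and "dilate3 (numeral m) = (numeral m :: 'a fps)"
    and "dilate3 fps_X = (fps_X ^ 3 :: 'a fps)"
  by (simp_all add: dilate3_def fps_compose_add_distrib fps_compose_sub_distrib fps_compose_uminus
      fps_compose_mult_distrib fps_compose_power numeral_fps_const)

lemma tendsto_dilate3 [tendsto_intros]:
  "(f \<longlongrightarrow> F) A \<Longrightarrow> ((\<lambda>x. dilate3 (f x)) \<longlongrightarrow> dilate3 F) A"
  by (auto simp: tendsto_fps_iff nth_dilate3)

lemma tendsto_section3 [tendsto_intros]:
  "(f \<longlongrightarrow> F) A \<Longrightarrow> ((\<lambda>x. section3 r (f x)) \<longlongrightarrow> section3 r F) A"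
  by (auto simp: tendsto_fps_iff section3_def)

lemma nth_dilate3_sum:
  shows "fps_nth (dilate3 a + fps_X * dilate3 b + fps_X ^ 2 * dilate3 c) (3 * m) = fps_nth a m"
    and "fps_nth (dilate3 a + fps_X * dilate3 b + fps_X ^ 2 * dilate3 c) (3 * m + 1) = fps_nth b m"
    and "fps_nth (dilate3 a + fps_X * dilate3 b + fps_X ^ 2 * dilate3 c) (3 * m + 2) = fps_nth c m"
proof -
  \<comment> \<open>On naturals 3 m - 1 and 3 m - 2 are 0 at m = 0, hence divisible by 3; this is
    why m = 0 is split off below.\<close>
  have ndvd: "\<not> 3 dvd 3 * m + 1" "\<not> 3 dvd 3 * m + 2" "m > 0 \<Longrightarrow> \<not> 3 dvd 3 * m - 1"
    "m > 0 \<Longrightarrow> \<not> 3 dvd 3 * m - 2" for m :: nat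
    by presburger+
  show "fps_nth (dilate3 a + fps_X * dilate3 b + fps_X ^ 2 * dilate3 c) (3 * m) = fps_nth a m"
    using ndvd(3,4)[of m] by (cases "m = 0") (simp_all add: nth_dilate3 fps_X_power_mult_nth)
  show "fps_nth (dilate3 a + fps_X * dilate3 b + fps_X ^ 2 * dilate3 c) (3 * m + 1) = fps_nth b m"
    using ndvd(1)[of m] ndvd(3)[of m]
    by (cases "m = 0") (simp_all add: nth_dilate3 fps_X_power_mult_nth)
  show "fps_nth (dilate3 a + fps_X * dilate3 b + fps_X ^ 2 * dilate3 c) (3 * m + 2) = fps_nth c m"
    using ndvd(1,2)[of m] by (simp add: nth_dilate3 fps_X_power_mult_nth)
qed

lemma section3_unique:
  assumes "F = dilate3 a + fps_X * dilate3 b + fps_X ^ 2 * dilate3 c"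
  shows "section3 0 F = a" "section3 1 F = b" "section3 2 F = c"
  \<comment> \<open>\<open>fps_nth_inverse\<close> is the round trip of the type definition, not a
    reciprocal.\<close>
  unfolding assms section3_def add_0_right nth_dilate3_sum by (simp_all only: fps_nth_inverse)

lemma section3_decompose:
  "F = dilate3 (section3 0 F) + fps_X * dilate3 (section3 1 F) + fps_X ^ 2 * dilate3 (section3 2 F)"
proof (rule fps_ext)
  fix n :: nat
  have "n = 3 * (n div 3) \<or> n = 3 * (n div 3) + 1 \<or> n = 3 * (n div 3) + 2"
    by presburger
  then obtain m where "n = 3 * m \<or> n = 3 * m + 1 \<or> n = 3 * m + 2"
    by blast
  then show "fps_nth F n = fps_nth (dilate3 (section3 0 F) + fps_X * dilate3 (section3 1 F) +
      fps_X ^ 2 * dilate3 (section3 2 F)) n"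
    by (elim disjE; hypsubst; unfold nth_dilate3_sum; simp add: section3_def)
qed

text \<open>Multiplication in the basis 1, q, q^2 over the series in q^3; the carry q^3 appears as
  \<open>fps_X\<close>.\<close>

lemma section3_mult:
  fixes F G :: "'a :: idom fps"
  shows "section3 0 (F * G) = section3 0 F * section3 0 G +
      fps_X * (section3 1 F * section3 2 G + section3 2 F * section3 1 G)"
    and "section3 1 (F * G) = section3 0 F * section3 1 G + section3 1 F * section3 0 G +
      fps_X * (section3 2 F * section3 2 G)"
    and "section3 2 (F * G) = section3 0 F * section3 2 G + section3 1 F * section3 1 G +
      section3 2 F * section3 0 G"
proof -
  define a b c where "a = section3 0 F" and "b = section3 1 F" and "c = section3 2 F"
  define a' b' c' where "a' = section3 0 G" and "b' = section3 1 G" and "c' = section3 2 G"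
  have "F * G = (dilate3 a + fps_X * dilate3 b + fps_X ^ 2 * dilate3 c) *
      (dilate3 a' + fps_X * dilate3 b' + fps_X ^ 2 * dilate3 c')"
    unfolding a_def b_def c_def a'_def b'_def c'_def by (simp only: section3_decompose[symmetric])
  also have "\<dots> = dilate3 (a * a' + fps_X * (b * c' + c * b')) +
      fps_X * dilate3 (a * b' + b * a' + fps_X * (c * c')) +
      fps_X ^ 2 * dilate3 (a * c' + b * b' + c * a')"
    by (simp add: algebra_simps eval_nat_numeral)
  finally have "F * G = dilate3 (a * a' + fps_X * (b * c' + c * b')) +
      fps_X * dilate3 (a * b' + b * a' + fps_X * (c * c')) +
      fps_X ^ 2 * dilate3 (a * c' + b * b' + c * a')" .
  from section3_unique[OF this] show
    "section3 0 (F * G) = section3 0 F * section3 0 G +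
      fps_X * (section3 1 F * section3 2 G + section3 2 F * section3 1 G)"
    "section3 1 (F * G) = section3 0 F * section3 1 G + section3 1 F * section3 0 G +
      fps_X * (section3 2 F * section3 2 G)"
    "section3 2 (F * G) = section3 0 F * section3 2 G + section3 1 F * section3 1 G +
      section3 2 F * section3 0 G"
    by (simp_all add: a_def b_def c_def a'_def b'_def c'_def)
qed

text \<open>
  The norm of \<open>F\<close> over the subring of power series in \<open>q^3\<close>, that is, \<open>F(q) F(\<omega>q) F(\<omega>\<^sup>2q)\<close> for a primitive
  cube root of unity \<open>\<omega>\<close>, with \<open>q^3\<close> replaced by \<open>q\<close> in the result.
\<close>

definition norm3 :: "'a :: comm_ring_1 fps \<Rightarrow> 'a fps" where
  "norm3 F = section3 0 F ^ 3 + fps_X * section3 1 F ^ 3 + fps_X ^ 2 * section3 2 F ^ 3 -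
    3 * fps_X * section3 0 F * section3 1 F * section3 2 F"

text \<open>The norm is the determinant of multiplication by F in this basis; on sections its
  multiplicativity is a polynomial identity.\<close>

lemma norm3_mult: "norm3 (F * G) = norm3 F * norm3 (G :: 'a :: idom fps)"
  unfolding norm3_def section3_mult by (simp add: algebra_simps power3_eq_cube power2_eq_square)

lemma norm3_dilate3: "norm3 (dilate3 F) = F ^ 3"
  using section3_unique[of "dilate3 F" F 0 0] by (simp add: norm3_def dilate3_def)

lemma tendsto_norm3 [tendsto_intros]:
  "(f \<longlongrightarrow> F) A \<Longrightarrow> ((\<lambda>x. norm3 (f x)) \<longlongrightarrow> norm3 F) A"
  unfolding norm3_def by (intro tendsto_intros)

lemma dilate3_fps_X_power: "dilate3 (fps_X ^ m) = (fps_X ^ (3 * m) :: 'a :: idom fps)"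
  by (simp add: power_mult)

text \<open>The three conjugates of 1 - q^m multiply to 1 - q^(3m), and q^3 is renamed q.\<close>

lemma norm3_one_minus_X_power:
  assumes "\<not> 3 dvd m"
  shows "norm3 (1 - fps_X ^ m) = (1 - fps_X ^ m :: 'a :: idom fps)"
proof -
  consider k where "m = 3 * k + 1" | k where "m = 3 * k + 2"
  proof -
    have "m = 3 * (m div 3) + m mod 3" "m mod 3 = 1 \<or> m mod 3 = 2"
      using assms by presburger+
    then show thesis
      using that by metis
  qed
  then show ?thesis
  proof cases
    case 1
    have "1 - fps_X ^ m = dilate3 1 + fps_X * dilate3 (- (fps_X ^ k)) + fps_X ^ 2 * dilate3 (0 :: 'a fps)"
      by (simp add: 1 power_mult)
    from section3_unique[OF this] show ?thesis
      by (simp add: norm3_def 1 power_mult mult.commute[of 3] flip: power_mult)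
  next
    case 2
    have "1 - fps_X ^ m = dilate3 1 + fps_X * dilate3 0 + fps_X ^ 2 * dilate3 (- (fps_X ^ k) :: 'a fps)"
      by (simp add: 2 power_mult power2_eq_square)
    from section3_unique[OF this] show ?thesis
      by (simp add: norm3_def 2 power_mult mult.commute[of 3] power2_eq_square flip: power_mult)
  qed
qed

text \<open>Factors of f_m with index not divisible by 3 contribute f_m / f_(3m) to the norm. The
  others are series in q^3 and contribute f_m^3.\<close>

lemma norm3_qf:
  assumes m: "\<not> 3 dvd m"
  shows "norm3 (qf m) * qf (3 * m) = qf m ^ 4"
proof -
  have m1: "m \<ge> 1"
    using m by (cases m) auto
  have partial: "norm3 (qf_partial m (3 * n)) * qf_partial (3 * m) (1 * n) =
      qf_partial m (1 * n) ^ 3 * qf_partial m (3 * n)" for n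
  proof (induction n)
    case 0
    show ?case
      using norm3_dilate3[of "1 :: rat fps"] by simp
  next
    case (Suc n)
    let ?Y = "\<lambda>k. 1 - fps_X ^ k :: rat fps"
    have 1: "qf_partial m (3 * Suc n) = qf_partial m (3 * n) *
        (?Y (m * (3 * n + 1)) * ?Y (m * (3 * n + 2)) * ?Y (m * (3 * n + 3)))"
      by (simp add: qf_partial_Suc eval_nat_numeral mult.assoc)
    have ndvd: "\<not> 3 dvd m * (3 * n + 1)" "\<not> 3 dvd m * (3 * n + 2)"
    proof -
      have "m * (3 * n + 1) = m + 3 * (m * n)" "m * (3 * n + 2) = 2 * m + 3 * (m * n)"
        by (simp_all add: algebra_simps)
      then show "\<not> 3 dvd m * (3 * n + 1)" "\<not> 3 dvd m * (3 * n + 2)"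
        using m by presburger+
    qed
    have "?Y (m * (3 * n + 3)) = dilate3 (?Y (m * Suc n))"
      unfolding dilate3_simps(4) dilate3_fps_X_power by (simp add: algebra_simps)
    then have 2: "norm3 (?Y (m * (3 * n + 3))) = ?Y (m * Suc n) ^ 3"
      by (simp only: norm3_dilate3)
    have 3: "m * (3 * n + 3) = 3 * m * Suc n"
      by (simp add: algebra_simps)
    have "norm3 (qf_partial m (3 * Suc n)) * qf_partial (3 * m) (1 * Suc n) =
        norm3 (qf_partial m (3 * n)) * qf_partial (3 * m) (1 * n) *
        (?Y (m * (3 * n + 1)) * ?Y (m * (3 * n + 2)) * ?Y (m * (3 * n + 3)) * ?Y (m * Suc n) ^ 3)"
      unfolding 1 norm3_mult norm3_one_minus_X_power[OF ndvd(1)] norm3_one_minus_X_power[OF ndvd(2)] 2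
        mult_1_left qf_partial_Suc 3[symmetric] by (simp only: mult_ac)
    also have "\<dots> = qf_partial m (1 * Suc n) ^ 3 * qf_partial m (3 * Suc n)"
      unfolding Suc.IH 1 unfolding mult_1_left qf_partial_Suc power_mult_distrib by (simp only: mult_ac)
    finally show ?case .
  qed
  have "(\<lambda>n. norm3 (qf_partial m (3 * n)) * qf_partial (3 * m) (1 * n))
      \<longlonglongrightarrow> norm3 (qf m) * qf (3 * m)"
    by (intro tendsto_intros qf_partial_tendsto) (use m1 in simp_all)
  moreover have "(\<lambda>n. norm3 (qf_partial m (3 * n)) * qf_partial (3 * m) (1 * n))
      \<longlonglongrightarrow> qf m ^ 3 * qf m"
    unfolding partial by (intro tendsto_intros qf_partial_tendsto) (use m1 in simp_all)
  ultimately have "norm3 (qf m) * qf (3 * m) = qf m ^ 3 * qf m"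
    by (rule LIMSEQ_unique)
  then show ?thesis
    by (simp add: eval_nat_numeral mult_ac)
qed

section \<open>Trisection of theta series\<close>

lemma dilate3_theta_term:
  "dilate3 (theta_term u v j) = theta_term (dilate3 u) (dilate3 (v :: 'a :: idom fps)) j"
  by (simp add: theta_term_def)

lemma dilate3_theta:
  fixes u v :: "'a :: idom fps"
  assumes "fps_nth (u * v) 0 = 0"
  shows "dilate3 (theta u v) = theta (dilate3 u) (dilate3 v)"
proof -
  have sum: "dilate3 (sum (theta_term u v) J) = sum (theta_term (dilate3 u) (dilate3 v)) J" for J
    by (induction J rule: infinite_finite_induct) (simp_all add: dilate3_theta_term)
  have "(theta_term (dilate3 u) (dilate3 v) has_sum dilate3 (theta u v)) UNIV"
    using tendsto_dilate3[OF has_sum_theta[OF assms, unfolded has_sum_def]]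
    by (simp add: has_sum_def sum)
  moreover have "fps_nth (dilate3 u * dilate3 v) 0 = 0"
    using assms by (simp add: nth_dilate3)
  then have "(theta_term (dilate3 u) (dilate3 v) has_sum theta (dilate3 u) (dilate3 v)) UNIV"
    by (rule has_sum_theta)
  ultimately show ?thesis
    by (rule has_sum_unique)
qed

text \<open>On each class 3k, 3k + 1, 3k - 1 the exponents stay quadratic in k, so the part is again
  a theta series, with arguments of product (u v)^9.\<close>

lemma theta_trisection:
  fixes u v :: "'a :: comm_ring_1 fps"
  assumes uv: "fps_nth (u * v) 0 = 0"
  shows "theta u v = theta (u ^ 6 * v ^ 3) (u ^ 3 * v ^ 6) +
    u * theta (u ^ 9 * v ^ 6) (v ^ 3) + v * theta (u ^ 3) (u ^ 6 * v ^ 9)"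
proof -
  have 9: "fps_nth (w * z) 0 = 0" if "w * z = (u * v) ^ 9" for w z
    unfolding that by (rule startsby_zero_power[OF uv]) simp
  have tri0: "triangle (3 * k) = 6 * triangle k + 3 * triangle (- k)" for k
    using of_nat_triangle[of "3 * k"] of_nat_triangle[of k] of_nat_triangle[of "- k"]
    by (simp add: algebra_simps flip: of_nat_eq_iff)
  have tri1: "triangle (3 * k + 1) = 9 * triangle k + 1" for k
    using of_nat_triangle[of "3 * k + 1"] of_nat_triangle[of k]
    by (simp add: algebra_simps flip: of_nat_eq_iff)
  \<comment> \<open>The class 3k - 1 represents residue 2 because negating j then exchanges it with
    3k + 1, so \<open>tri1\<close> and \<open>tri2\<close> supply the exponents of both u and
    v.\<close>
  have tri2: "triangle (3 * k - 1) = 3 * triangle k + 6 * triangle (- k)" for k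
    using of_nat_triangle[of "3 * k - 1"] of_nat_triangle[of k] of_nat_triangle[of "- k"]
    by (simp add: algebra_simps flip: of_nat_eq_iff)
  have T0: "theta_term u v (3 * k) = theta_term (u ^ 6 * v ^ 3) (u ^ 3 * v ^ 6) k" for k
    using tri0[of k] tri0[of "- k"]
    by (simp add: theta_term_def power_mult_distrib power_add mult_ac flip: power_mult)
  have T1: "theta_term u v (3 * k + 1) = u * theta_term (u ^ 9 * v ^ 6) (v ^ 3) k" for k
    using tri1[of k] tri2[of "- k"]
    by (simp add: theta_term_def power_mult_distrib power_add mult_ac flip: power_mult)
  have T2: "theta_term u v (3 * k - 1) = v * theta_term (u ^ 3) (u ^ 6 * v ^ 9) k" for k
    using tri2[of k] tri1[of "- k"]
    by (simp add: theta_term_def power_mult_distrib power_add mult_ac flip: power_mult)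
  have "(u ^ 6 * v ^ 3) * (u ^ 3 * v ^ 6) = (u * v) ^ 9" "(u ^ 9 * v ^ 6) * v ^ 3 = (u * v) ^ 9"
    "u ^ 3 * (u ^ 6 * v ^ 9) = (u * v) ^ 9"
    by (simp_all add: power_mult_distrib eval_nat_numeral mult_ac)
  note sums = this[THEN 9, THEN has_sum_theta]
  have S0: "(theta_term u v has_sum theta (u ^ 6 * v ^ 3) (u ^ 3 * v ^ 6)) (range (\<lambda>k. 3 * k))"
    using sums(1) by (subst has_sum_reindex) (auto simp: inj_on_def o_def T0)
  have S1: "(theta_term u v has_sum u * theta (u ^ 9 * v ^ 6) (v ^ 3)) (range (\<lambda>k. 3 * k + 1))"
    using has_sum_cmult_right[OF sums(2)] by (subst has_sum_reindex) (auto simp: inj_on_def o_def T1)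
  have S2: "(theta_term u v has_sum v * theta (u ^ 3) (u ^ 6 * v ^ 9)) (range (\<lambda>k. 3 * k - 1))"
    using has_sum_cmult_right[OF sums(3)] by (subst has_sum_reindex) (auto simp: inj_on_def o_def T2)
  have "(theta_term u v has_sum theta (u ^ 6 * v ^ 3) (u ^ 3 * v ^ 6) +
      u * theta (u ^ 9 * v ^ 6) (v ^ 3) + v * theta (u ^ 3) (u ^ 6 * v ^ 9))
      (range (\<lambda>k. 3 * k) \<union> range (\<lambda>k. 3 * k + 1) \<union> range (\<lambda>k. 3 * k - 1))"
    by (intro has_sum_Un_disjoint S0 S1 S2; auto; presburger)
  also have "range (\<lambda>k. 3 * k) \<union> range (\<lambda>k. 3 * k + 1) \<union> range (\<lambda>k. 3 * k - 1) = (UNIV :: int set)"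
  proof -
    have "j = 3 * (j div 3) \<or> j = 3 * (j div 3) + 1 \<or> j = 3 * (j div 3 + 1) - 1" for j :: int
      by presburger
    then show ?thesis
      by blast
  qed
  finally show ?thesis
    using has_sum_theta[OF uv] has_sum_unique by blast
qed

lemma dilate3_qf:
  assumes "m \<ge> 1"
  shows "dilate3 (qf m) = qf (3 * m)"
proof -
  have "dilate3 (qf_partial m n) = qf_partial (3 * m) n" for n
  proof (induction n)
    case (Suc n)
    have "dilate3 (1 - fps_X ^ (m * Suc n)) = (1 - fps_X ^ (3 * m * Suc n) :: rat fps)"
      unfolding dilate3_simps(2,4) dilate3_fps_X_power by (simp only: mult.assoc)
    then show ?case
      unfolding qf_partial_Suc dilate3_simps(6) Suc.IH by simp
  qed simp
  then have "(\<lambda>n. qf_partial (3 * m) (1 * n)) \<longlonglongrightarrow> dilate3 (qf m)"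
    using tendsto_dilate3[OF qf_partial_tendsto[OF assms, of 1]] by simp
  moreover have "(\<lambda>n. qf_partial (3 * m) (1 * n)) \<longlonglongrightarrow> qf (3 * m)"
    using assms by (intro qf_partial_tendsto) auto
  ultimately show ?thesis
    by (rule LIMSEQ_unique)
qed

lemma dilate3_inverse:
  fixes F :: "'a :: field fps"
  assumes "fps_nth F 0 \<noteq> 0"
  shows "dilate3 (inverse F) = inverse (dilate3 F)"
  unfolding dilate3_def using assms by (intro fps_inverse_compose) simp_all

lemma section3_dilate3 [simp]:
  "section3 0 (dilate3 F) = F" "section3 1 (dilate3 F) = 0" "section3 2 (dilate3 F) = 0"
  using section3_unique[of "dilate3 F" F 0 0] by (simp_all add: dilate3_def)

text \<open>The exponents j^2 are never 2 modulo 3, and the classes of 1 and -1 give equal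
  parts.\<close>

lemma section3_theta_X_X:
  fixes \<phi> :: "rat fps"
  defines "\<phi> \<equiv> theta (- fps_X) (- fps_X)"
  shows "section3 0 \<phi> = dilate3 \<phi>" "section3 1 \<phi> = - 2 * theta (- fps_X) (- (fps_X ^ 5))"
    "section3 2 \<phi> = 0"
proof -
  let ?\<alpha> = "theta (- fps_X) (- (fps_X ^ 5)) :: rat fps"
  have "dilate3 (dilate3 \<phi>) = theta (- (fps_X ^ 9)) (- (fps_X ^ 9))"
    by (simp add: \<phi>_def dilate3_theta flip: power_mult)
  moreover have "dilate3 ?\<alpha> = theta (- (fps_X ^ 3)) (- (fps_X ^ 15))"
    by (simp add: dilate3_theta flip: power_mult)
  moreover have "(- fps_X) ^ 6 * (- fps_X) ^ 3 = (- (fps_X ^ 9) :: rat fps)"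
    "(- fps_X) ^ 3 * (- fps_X) ^ 6 = (- (fps_X ^ 9) :: rat fps)"
    "(- fps_X) ^ 9 * (- fps_X) ^ 6 = (- (fps_X ^ 15) :: rat fps)"
    "(- fps_X) ^ 6 * (- fps_X) ^ 9 = (- (fps_X ^ 15) :: rat fps)"
    "(- fps_X) ^ 3 = (- (fps_X ^ 3) :: rat fps)"
    by (simp_all flip: power_add)
  ultimately have "\<phi> = dilate3 (dilate3 \<phi>) + fps_X * dilate3 (- 2 * ?\<alpha>) + fps_X ^ 2 * dilate3 0"
    using theta_trisection[of "- fps_X :: rat fps" "- fps_X"]
    by (simp add: \<phi>_def theta_commute[of "- (fps_X ^ 15)"])
  then show "section3 0 \<phi> = dilate3 \<phi>" "section3 1 \<phi> = - 2 * ?\<alpha>" "section3 2 \<phi> = 0"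
    by (rule section3_unique)+
qed

text \<open>Triangular numbers are never 2 modulo 3, and the classes 3k and 3k + 1 give equal
  parts.\<close>

lemma section3_theta_1_X:
  fixes \<psi> :: "rat fps"
  defines "\<psi> \<equiv> theta 1 fps_X"
  shows "section3 0 \<psi> = 2 * theta fps_X (fps_X ^ 2)" "section3 1 \<psi> = dilate3 \<psi>" "section3 2 \<psi> = 0"
proof -
  let ?\<beta> = "theta fps_X (fps_X ^ 2) :: rat fps"
  have "dilate3 (dilate3 \<psi>) = theta 1 (fps_X ^ 9)"
    by (simp add: \<psi>_def dilate3_theta flip: power_mult)
  moreover have "dilate3 ?\<beta> = theta (fps_X ^ 3) (fps_X ^ 6)"
    by (simp add: dilate3_theta flip: power_mult)
  ultimately have "\<psi> = dilate3 (2 * ?\<beta>) + fps_X * dilate3 (dilate3 \<psi>) + fps_X ^ 2 * dilate3 0"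
    using theta_trisection[of 1 "fps_X :: rat fps"]
    by (simp add: \<psi>_def theta_commute[of "fps_X ^ 6"])
  then show "section3 0 \<psi> = 2 * ?\<beta>" "section3 1 \<psi> = dilate3 \<psi>" "section3 2 \<psi> = 0"
    by (rule section3_unique)+
qed

section \<open>The 3-dissection of f_1 f_2\<close>

text \<open>Eta quotients are simplified in the field of Laurent series and pulled back by
  injectivity.\<close>

lemma fps_to_fls_inverse_unit:
  "fps_nth F 0 \<noteq> 0 \<Longrightarrow> fps_to_fls (inverse F) = inverse (fps_to_fls (F :: 'a :: field fps))"
  by (rule fls_inverse_fps_to_fls[symmetric]) (simp add: subdegree_eq_0_iff)

lemma fps_to_fls_divide_unit:
  "fps_nth G 0 \<noteq> 0 \<Longrightarrow> fps_to_fls (F / G) = fps_to_fls F / fps_to_fls (G :: 'a :: field fps)"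
  by (simp add: fps_divide_unit fls_times_fps_to_fls fps_to_fls_inverse_unit field_simps)

lemma nth_0_qf [simp]: "fps_nth (qf 1) 0 = 1" "fps_nth (qf (Suc 0)) 0 = 1"
  "fps_nth (qf (numeral k)) 0 = 1"
  by (simp_all add: qf_has_prod(2))

text \<open>Multiply the dissections of phi(-q) and 2 psi(q), whose product is 2 f_1 f_2.\<close>

lemma section3_qf1_qf2:
  "section3 0 (qf 1 * qf 2) = qf 2 * qf 3 ^ 4 / (qf 1 * qf 6 ^ 2)"
  "section3 1 (qf 1 * qf 2) = - (qf 3 * qf 6)"
  "section3 2 (qf 1 * qf 2) = - 2 * (qf 1 * qf 6 ^ 4 / (qf 2 * qf 3 ^ 2))"
proof -
  let ?\<phi> = "theta (- fps_X) (- fps_X) :: rat fps" and ?\<psi> = "theta 1 fps_X :: rat fps"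
  let ?\<alpha> = "theta (- fps_X) (- (fps_X ^ 5)) :: rat fps" and ?\<beta> = "theta fps_X (fps_X ^ 2) :: rat fps"
  let ?L = "fps_to_fls"
  define f1 f2 f3 f6 where f_def: "f1 = qf 1" "f2 = qf 2" "f3 = qf 3" "f6 = qf 6"
  have nz: "?L f1 \<noteq> 0" "?L f2 \<noteq> 0" "?L f3 \<noteq> 0" "?L f6 \<noteq> 0"
    by (simp_all add: f_def)
  have nth: "fps_nth f1 0 = 1" "fps_nth f2 0 = 1" "fps_nth f3 0 = 1" "fps_nth f6 0 = 1"
    by (simp_all add: f_def)
  have d: "dilate3 f1 = f3" "dilate3 f2 = f6"
    using dilate3_qf[of 1] dilate3_qf[of 2] by (simp_all add: f_def)
  have L\<phi>: "?L ?\<phi> = ?L f1 ^ 2 / ?L f2"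
    unfolding theta_X_X f_def[symmetric] using nz nth
    by (simp add: fls_times_fps_to_fls fps_to_fls_power fps_to_fls_inverse_unit
        field_simps power2_eq_square)
  have L\<psi>: "?L ?\<psi> = 2 * ?L f2 ^ 2 / ?L f1"
    unfolding theta_1_X f_def[symmetric] using nz nth
    by (simp add: fls_times_fps_to_fls fps_to_fls_power fps_to_fls_inverse_unit
        field_simps power2_eq_square)
  have L\<alpha>: "?L ?\<alpha> = ?L f1 * ?L f6 ^ 2 / (?L f2 * ?L f3)"
    unfolding theta_X_X5 f_def[symmetric] using nz nth
    by (simp add: fls_times_fps_to_fls fps_to_fls_power fps_to_fls_inverse_unit
        field_simps power2_eq_square)
  have L\<beta>: "?L ?\<beta> = ?L f2 * ?L f3 ^ 2 / (?L f1 * ?L f6)"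
    unfolding theta_X_X2 f_def[symmetric] using nz nth
    by (simp add: fls_times_fps_to_fls fps_to_fls_power fps_to_fls_inverse_unit
        field_simps power2_eq_square)
  have L\<phi>': "?L (dilate3 ?\<phi>) = ?L f3 ^ 2 / ?L f6"
    unfolding theta_X_X f_def[symmetric] using nz nth
    by (simp add: dilate3_inverse d fls_times_fps_to_fls fps_to_fls_power fps_to_fls_inverse_unit
        field_simps power2_eq_square)
  have L\<psi>': "?L (dilate3 ?\<psi>) = 2 * ?L f6 ^ 2 / ?L f3"
    unfolding theta_1_X f_def[symmetric] using nz nth
    by (simp add: dilate3_inverse d fls_times_fps_to_fls fps_to_fls_power fps_to_fls_inverse_unit
        field_simps power2_eq_square)
  have "?L (?\<phi> * ?\<psi>) = ?L (2 * (f1 * f2))"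
    unfolding fls_times_fps_to_fls L\<phi> L\<psi> using nz by (simp add: field_simps power2_eq_square)
  then have "?\<phi> * ?\<psi> = 2 * (f1 * f2)"
    by (simp only: fps_to_fls_eq_iff)
  then have s: "2 * section3 r (f1 * f2) = section3 r (?\<phi> * ?\<psi>)" for r
    by (simp add: section3_def fps_eq_iff numeral_fps_const)
  have "2 * section3 0 (f1 * f2) = dilate3 ?\<phi> * (2 * ?\<beta>)"
    "2 * section3 1 (f1 * f2) = dilate3 ?\<phi> * dilate3 ?\<psi> - 4 * ?\<alpha> * ?\<beta>"
    "2 * section3 2 (f1 * f2) = - 2 * ?\<alpha> * dilate3 ?\<psi>"
    unfolding s unfolding section3_mult section3_theta_X_X section3_theta_1_X
    by (simp_all only: mult_zero_left mult_zero_right add_0_left add_0_right) simp_all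
  then have "?L (2 * section3 0 (f1 * f2)) = ?L (dilate3 ?\<phi> * (2 * ?\<beta>))"
    "?L (2 * section3 1 (f1 * f2)) = ?L (dilate3 ?\<phi> * dilate3 ?\<psi> - 4 * ?\<alpha> * ?\<beta>)"
    "?L (2 * section3 2 (f1 * f2)) = ?L (- 2 * ?\<alpha> * dilate3 ?\<psi>)"
    by (simp_all only:)
  then have "2 * ?L (section3 0 (f1 * f2)) = 2 * (?L (dilate3 ?\<phi>) * ?L ?\<beta>)"
    "2 * ?L (section3 1 (f1 * f2)) = ?L (dilate3 ?\<phi>) * ?L (dilate3 ?\<psi>) - 4 * (?L ?\<alpha> * ?L ?\<beta>)"
    "2 * ?L (section3 2 (f1 * f2)) = 2 * - (?L ?\<alpha> * ?L (dilate3 ?\<psi>))"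
    by (simp_all add: fls_times_fps_to_fls)
  \<comment> \<open>Both contributions to the middle section are multiples of f_3 f_6, with
    coefficients 2 and -4.\<close>
  moreover have "?L (dilate3 ?\<phi>) * ?L (dilate3 ?\<psi>) = 2 * (?L f3 * ?L f6)"
    "?L ?\<alpha> * ?L ?\<beta> = ?L f3 * ?L f6"
    unfolding L\<alpha> L\<beta> L\<phi>' L\<psi>' using nz by (simp_all add: field_simps power2_eq_square)
  moreover have "2 * y - 4 * y = 2 * - y" for y :: "rat fls"
    by (simp flip: left_diff_distrib)
  moreover have two: "(2 :: rat fls) \<noteq> 0"
    using fps_to_fls_eq_0_iff[of "2 :: rat fps"] by (simp del: fps_to_fls_eq_0_iff)
  ultimately have "?L (section3 0 (f1 * f2)) = ?L (dilate3 ?\<phi>) * ?L ?\<beta>"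
    "?L (section3 1 (f1 * f2)) = - (?L f3 * ?L f6)"
    "?L (section3 2 (f1 * f2)) = - (?L ?\<alpha> * ?L (dilate3 ?\<psi>))"
    by (simp_all only: mult_left_cancel[OF two])
  then have *: "?L (section3 0 (f1 * f2)) = ?L f2 * ?L f3 ^ 4 / (?L f1 * ?L f6 ^ 2)"
    "?L (section3 1 (f1 * f2)) = - (?L f3 * ?L f6)"
    "?L (section3 2 (f1 * f2)) = - 2 * (?L f1 * ?L f6 ^ 4 / (?L f2 * ?L f3 ^ 2))"
    unfolding L\<alpha> L\<beta> L\<phi>' L\<psi>' using nz
    by (simp_all add: field_simps eval_nat_numeral)
  have "?L (section3 0 (f1 * f2)) = ?L (f2 * f3 ^ 4 / (f1 * f6 ^ 2))"
    "?L (section3 1 (f1 * f2)) = ?L (- (f3 * f6))"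
    "?L (section3 2 (f1 * f2)) = ?L (- 2 * (f1 * f6 ^ 4 / (f2 * f3 ^ 2)))"
    using * nth
    by (simp_all add: fls_times_fps_to_fls fps_to_fls_power fps_to_fls_divide_unit)
  then show "section3 0 (qf 1 * qf 2) = qf 2 * qf 3 ^ 4 / (qf 1 * qf 6 ^ 2)"
    "section3 1 (qf 1 * qf 2) = - (qf 3 * qf 6)"
    "section3 2 (qf 1 * qf 2) = - 2 * (qf 1 * qf 6 ^ 4 / (qf 2 * qf 3 ^ 2))"
    by (simp_all only: fps_to_fls_eq_iff f_def)
qed

section \<open>Conjugates and the generating function\<close>

text \<open>The product \<open>F(\<omega>q) F(\<omega>\<^sup>2q)\<close> of the conjugates of \<open>F\<close>.\<close>

definition conjugate3 :: "'a :: comm_ring_1 fps \<Rightarrow> 'a fps" where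
  "conjugate3 F =
    dilate3 (section3 0 F ^ 2 - fps_X * section3 1 F * section3 2 F) +
    fps_X * dilate3 (fps_X * section3 2 F ^ 2 - section3 0 F * section3 1 F) +
    fps_X ^ 2 * dilate3 (section3 1 F ^ 2 - section3 0 F * section3 2 F)"

lemmas section3_conjugate3 = section3_unique[OF conjugate3_def]

text \<open>Turns division by F into division by a series in q^3, without adjoining a cube root of
  unity.\<close>

lemma mult_conjugate3: "F * conjugate3 F = dilate3 (norm3 (F :: 'a :: idom fps))"
proof -
  have "section3 0 (F * conjugate3 F) = norm3 F" "section3 1 (F * conjugate3 F) = 0"
    "section3 2 (F * conjugate3 F) = 0"
    unfolding section3_mult section3_conjugate3 norm3_def
    by (simp_all add: algebra_simps eval_nat_numeral)
  then show ?thesis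
    using section3_decompose[of "F * conjugate3 F"] by simp
qed

text \<open>Here x stands for q, \<open>s0\<close>, \<open>s1\<close>, \<open>s2\<close> for the
  sections of f_1 f_2, \<open>c0\<close>, \<open>c1\<close>, \<open>c2\<close> for those of its
  conjugate product, and \<open>K\<close> for the factor left by the norm. The left sides are
  \<open>K\<close> times the sections of the squared conjugate product.\<close>

lemma trisection_algebra:
  fixes x f1 f2 f3 f6 :: "'a :: field"
  assumes nz: "f1 \<noteq> 0" "f2 \<noteq> 0" "f3 \<noteq> 0" "f6 \<noteq> 0"
  defines "K \<equiv> f3 ^ 2 * f6 ^ 2 / (f1 ^ 2 * f2 ^ 2)"
    and "s0 \<equiv> f2 * f3 ^ 4 / (f1 * f6 ^ 2)" and "s1 \<equiv> - (f3 * f6)"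
    and "s2 \<equiv> - 2 * (f1 * f6 ^ 4 / (f2 * f3 ^ 2))"
  defines "c0 \<equiv> s0 ^ 2 - x * s1 * s2" and "c1 \<equiv> x * s2 ^ 2 - s0 * s1" and "c2 \<equiv> s1 ^ 2 - s0 * s2"
  shows "K * (c0 * c0 + x * (c1 * c2 + c2 * c1)) =
      f2 ^ 2 * f3 ^ 18 / (f1 ^ 6 * f6 ^ 6) + 2 * x * (f3 ^ 9 * f6 ^ 3 / (f1 ^ 3 * f2)) +
      28 * x ^ 2 * (f6 ^ 12 / f2 ^ 4)"
    and "K * (c0 * c1 + c1 * c0 + x * (c2 * c2)) =
      2 * (f2 * f3 ^ 15 / (f1 ^ 5 * f6 ^ 3)) + 13 * x * (f3 ^ 6 * f6 ^ 6 / (f1 ^ 2 * f2 ^ 2)) -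
      16 * x ^ 2 * (f1 * f6 ^ 15 / (f2 ^ 5 * f3 ^ 3))"
    and "K * (c0 * c2 + c1 * c1 + c2 * c0) =
      7 * (f3 ^ 12 / f1 ^ 4) - 4 * x * (f3 ^ 3 * f6 ^ 9 / (f1 * f2 ^ 3)) +
      16 * x ^ 2 * (f1 ^ 2 * f6 ^ 18 / (f2 ^ 6 * f3 ^ 6))"
proof -
  \<comment> \<open>After this substitution all terms of the three sums are of the form \<open>c x^i K s0^4 t^k\<close>.\<close>
  define t where "t = f1 * f6 ^ 3 / (f2 * f3 ^ 3)"
  have s: "s1 = - (s0 * t)" "s2 = - 2 * (s0 * t ^ 2)"
    using nz by (simp_all add: s0_def s1_def s2_def t_def field_simps eval_nat_numeral)
  have c: "c0 = s0 ^ 2 * (1 - 2 * x * t ^ 3)" "c1 = s0 ^ 2 * (t + 4 * x * t ^ 4)" "c2 = s0 ^ 2 * (3 * t ^ 2)"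
    by (simp_all add: c0_def c1_def c2_def s algebra_simps eval_nat_numeral)
  have Ks0: "K * s0 ^ 4 = f2 ^ 2 * f3 ^ 18 / (f1 ^ 6 * f6 ^ 6)"
    using nz by (simp add: K_def s0_def field_simps eval_nat_numeral)
  \<comment> \<open>All nine monomials have the form p^(6 - k) r^(k - 2), where k is the power of
    t.\<close>
  define p r where "p = f3 ^ 3 / f1" and "r = f6 ^ 3 / f2"
  have pr: "p \<noteq> 0" "r \<noteq> 0" "t = r / p"
    using nz by (simp_all add: p_def r_def t_def)
  have "f2 ^ 2 * f3 ^ 18 / (f1 ^ 6 * f6 ^ 6) = p ^ 6 / r ^ 2"
    "f2 * f3 ^ 15 / (f1 ^ 5 * f6 ^ 3) = p ^ 5 / r"
    "f3 ^ 12 / f1 ^ 4 = p ^ 4"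
    "f3 ^ 9 * f6 ^ 3 / (f1 ^ 3 * f2) = p ^ 3 * r"
    "f3 ^ 6 * f6 ^ 6 / (f1 ^ 2 * f2 ^ 2) = p ^ 2 * r ^ 2"
    "f3 ^ 3 * f6 ^ 9 / (f1 * f2 ^ 3) = p * r ^ 3"
    "f6 ^ 12 / f2 ^ 4 = r ^ 4"
    "f1 * f6 ^ 15 / (f2 ^ 5 * f3 ^ 3) = r ^ 5 / p"
    "f1 ^ 2 * f6 ^ 18 / (f2 ^ 6 * f3 ^ 6) = r ^ 6 / p ^ 2"
    by (simp_all add: p_def r_def power_divide mult_ac flip: power_mult)
  note monomials = this
  have M: "K * s0 ^ 4 * t = p ^ 5 / r" "K * s0 ^ 4 * t ^ 2 = p ^ 4" "K * s0 ^ 4 * t ^ 3 = p ^ 3 * r"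
    "K * s0 ^ 4 * t ^ 4 = p ^ 2 * r ^ 2" "K * s0 ^ 4 * t ^ 5 = p * r ^ 3" "K * s0 ^ 4 * t ^ 6 = r ^ 4"
    "K * s0 ^ 4 * t ^ 7 = r ^ 5 / p" "K * s0 ^ 4 * t ^ 8 = r ^ 6 / p ^ 2"
    unfolding Ks0 monomials pr(3) using pr(1,2) by (simp_all add: field_simps eval_nat_numeral)
  \<comment> \<open>Expanding the square gives 2 = -4 + 6 and 28 = 4 + 24; below, 13 = 8 - 4 + 9,
    then 7 = 6 + 1 and -4 = -12 + 8.\<close>
  have "K * (c0 * c0 + x * (c1 * c2 + c2 * c1)) = K * s0 ^ 4 * (1 + 2 * x * t ^ 3 + 28 * x ^ 2 * t ^ 6)"
    by (simp add: c algebra_simps eval_nat_numeral)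
  also have "\<dots> = f2 ^ 2 * f3 ^ 18 / (f1 ^ 6 * f6 ^ 6) + 2 * x * (f3 ^ 9 * f6 ^ 3 / (f1 ^ 3 * f2)) +
      28 * x ^ 2 * (f6 ^ 12 / f2 ^ 4)"
    unfolding monomials M[symmetric]
    unfolding monomials(1)[symmetric] Ks0[symmetric] by (simp only: algebra_simps mult_1_left)
  finally show "K * (c0 * c0 + x * (c1 * c2 + c2 * c1)) = \<dots>" .
  have "K * (c0 * c1 + c1 * c0 + x * (c2 * c2)) =
      K * s0 ^ 4 * (2 * t + 13 * x * t ^ 4 - 16 * x ^ 2 * t ^ 7)"
    by (simp add: c algebra_simps eval_nat_numeral)
  also have "\<dots> = 2 * (f2 * f3 ^ 15 / (f1 ^ 5 * f6 ^ 3)) + 13 * x * (f3 ^ 6 * f6 ^ 6 / (f1 ^ 2 * f2 ^ 2)) -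
      16 * x ^ 2 * (f1 * f6 ^ 15 / (f2 ^ 5 * f3 ^ 3))"
    unfolding monomials M[symmetric]
    unfolding monomials(1)[symmetric] Ks0[symmetric] by (simp only: algebra_simps mult_1_left)
  finally show "K * (c0 * c1 + c1 * c0 + x * (c2 * c2)) = \<dots>" .
  have "K * (c0 * c2 + c1 * c1 + c2 * c0) =
      K * s0 ^ 4 * (7 * t ^ 2 - 4 * x * t ^ 5 + 16 * x ^ 2 * t ^ 8)"
    by (simp add: c algebra_simps eval_nat_numeral)
  also have "\<dots> = 7 * (f3 ^ 12 / f1 ^ 4) - 4 * x * (f3 ^ 3 * f6 ^ 9 / (f1 * f2 ^ 3)) +
      16 * x ^ 2 * (f1 ^ 2 * f6 ^ 18 / (f2 ^ 6 * f3 ^ 6))"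
    unfolding monomials M[symmetric]
    unfolding monomials(1)[symmetric] Ks0[symmetric] by (simp only: algebra_simps mult_1_left)
  finally show "K * (c0 * c2 + c1 * c1 + c2 * c0) = \<dots>" .
qed

text \<open>The reciprocal of f_1 f_2 is its conjugate product over its norm in q^3. The numerator
  is (f_1 f_2)^6 in q^3, and dividing (f_1 f_2)^6 by the squared norm leaves
  \<open>K\<close>.\<close>

lemma CP3_series_factorization:
  "qf 3 ^ 6 * qf 6 ^ 6 / (qf 1 ^ 2 * qf 2 ^ 2) =
    dilate3 (qf 3 ^ 2 * qf 6 ^ 2 / (qf 1 ^ 2 * qf 2 ^ 2)) *
    (conjugate3 (qf 1 * qf 2) * conjugate3 (qf 1 * qf 2))"
proof -
  let ?L = "fps_to_fls" and ?N = "norm3 (qf 1 * qf 2)" and ?C = "conjugate3 (qf 1 * qf 2)"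
  define K where "K = qf 3 ^ 2 * qf 6 ^ 2 / (qf 1 ^ 2 * qf 2 ^ 2)"
  define f1 f2 f3 f6 where f_def: "f1 = qf 1" "f2 = qf 2" "f3 = qf 3" "f6 = qf 6"
  define n where "n = ?N"
  have nz: "?L f1 \<noteq> 0" "?L f2 \<noteq> 0" "?L f3 \<noteq> 0" "?L f6 \<noteq> 0"
    by (simp_all add: f_def)
  have nth: "fps_nth f1 0 = 1" "fps_nth f2 0 = 1"
    by (simp_all add: f_def)
  have "n * (f3 * f6) = (norm3 f1 * f3) * (norm3 f2 * f6)"
    by (simp only: n_def f_def norm3_mult mult_ac)
  also have "\<dots> = f1 ^ 4 * f2 ^ 4"
    using norm3_qf[of 1] norm3_qf[of 2] by (simp add: f_def)
  finally have "?L (n * (f3 * f6)) = ?L (f1 ^ 4 * f2 ^ 4)"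
    by (simp only:)
  then have N: "?L n = ?L f1 ^ 4 * ?L f2 ^ 4 / (?L f3 * ?L f6)"
    using nz by (simp add: fls_times_fps_to_fls fps_to_fls_power field_simps)
  have "?L (K * n ^ 2) = ?L ((f1 * f2) ^ 6)"
    unfolding K_def f_def[symmetric] using nz nth
    by (simp add: fls_times_fps_to_fls fps_to_fls_power fps_to_fls_divide_unit N
        field_simps eval_nat_numeral)
  then have KN: "K * ?N ^ 2 = (qf 1 * qf 2) ^ 6"
    by (simp only: fps_to_fls_eq_iff f_def n_def)
  have d: "dilate3 (qf 1) = qf 3" "dilate3 (qf 2) = qf 6"
    using dilate3_qf[of 1] dilate3_qf[of 2] by simp_all
  have "qf 3 ^ 6 * qf 6 ^ 6 = dilate3 ((qf 1 * qf 2) ^ 6)"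
    by (simp only: dilate3_simps d power_mult_distrib)
  also have "\<dots> = dilate3 K * dilate3 ?N ^ 2"
    unfolding KN[symmetric] by simp
  also have "\<dots> = dilate3 K * (?C * ?C) * (qf 1 ^ 2 * qf 2 ^ 2)"
    unfolding mult_conjugate3[symmetric] by (simp add: power2_eq_square mult_ac)
  finally have "qf 3 ^ 6 * qf 6 ^ 6 / (qf 1 ^ 2 * qf 2 ^ 2) =
      dilate3 K * (?C * ?C) * (qf 1 ^ 2 * qf 2 ^ 2) / (qf 1 ^ 2 * qf 2 ^ 2)"
    by (simp only:)
  also have "\<dots> = dilate3 K * (?C * ?C)"
    by (rule nonzero_mult_div_cancel_right) simp
  finally show ?thesis
    by (simp only: K_def)
qed

theorem theorem3p3:
  shows "Abs_fps (\<lambda>n. CP3 (3 * n)) =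
             qf 2 ^ 2 * qf 3 ^ 18 / (qf 1 ^ 6 * qf 6 ^ 6)
           + 2 * fps_X * (qf 3 ^ 9 * qf 6 ^ 3 / (qf 1 ^ 3 * qf 2))
           + 28 * fps_X ^ 2 * (qf 6 ^ 12 / qf 2 ^ 4)
       \<and> Abs_fps (\<lambda>n. CP3 (3 * n + 1)) =
             2 * (qf 2 * qf 3 ^ 15 / (qf 1 ^ 5 * qf 6 ^ 3))
           + 13 * fps_X * (qf 3 ^ 6 * qf 6 ^ 6 / (qf 1 ^ 2 * qf 2 ^ 2))
           - 16 * fps_X ^ 2 * (qf 1 * qf 6 ^ 15 / (qf 2 ^ 5 * qf 3 ^ 3))
       \<and> Abs_fps (\<lambda>n. CP3 (3 * n + 2)) =
             7 * (qf 3 ^ 12 / qf 1 ^ 4)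
           - 4 * fps_X * (qf 3 ^ 3 * qf 6 ^ 9 / (qf 1 * qf 2 ^ 3))
           + 16 * fps_X ^ 2 * (qf 1 ^ 2 * qf 6 ^ 18 / (qf 2 ^ 6 * qf 3 ^ 6))"
proof -
  let ?L = "fps_to_fls"
  define f1 f2 f3 f6 where f_def: "f1 = qf 1" "f2 = qf 2" "f3 = qf 3" "f6 = qf 6"
  define G where "G = f3 ^ 6 * f6 ^ 6 / (f1 ^ 2 * f2 ^ 2)"
  define K where "K = f3 ^ 2 * f6 ^ 2 / (f1 ^ 2 * f2 ^ 2)"
  define s0 s1 s2 where "s0 = f2 * f3 ^ 4 / (f1 * f6 ^ 2)" and "s1 = - (f3 * f6)"
    and "s2 = - 2 * (f1 * f6 ^ 4 / (f2 * f3 ^ 2))"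
  define c0 c1 c2 where "c0 = s0 ^ 2 - fps_X * s1 * s2" and "c1 = fps_X * s2 ^ 2 - s0 * s1"
    and "c2 = s1 ^ 2 - s0 * s2"
  have LHS: "Abs_fps (\<lambda>n. CP3 (3 * n)) = section3 0 G" "Abs_fps (\<lambda>n. CP3 (3 * n + 1)) = section3 1 G"
    "Abs_fps (\<lambda>n. CP3 (3 * n + 2)) = section3 2 G"
    by (simp_all add: section3_def CP3_def G_def f_def)
  define C where "C = conjugate3 (f1 * f2)"
  have C: "section3 0 C = c0" "section3 1 C = c1" "section3 2 C = c2"
    unfolding C_def f_def section3_conjugate3 section3_qf1_qf2
    by (simp_all only: s0_def s1_def s2_def c0_def c1_def c2_def f_def)
  have sections: "section3 0 G = K * (c0 * c0 + fps_X * (c1 * c2 + c2 * c1))"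
    "section3 1 G = K * (c0 * c1 + c1 * c0 + fps_X * (c2 * c2))"
    "section3 2 G = K * (c0 * c2 + c1 * c1 + c2 * c0)"
    unfolding G_def f_def CP3_series_factorization
    unfolding f_def[symmetric] K_def[symmetric] C_def[symmetric]
    unfolding section3_mult section3_dilate3 C
    by simp_all
  have nz: "?L f1 \<noteq> 0" "?L f2 \<noteq> 0" "?L f3 \<noteq> 0" "?L f6 \<noteq> 0"
    by (simp_all add: f_def)
  have nth: "fps_nth f1 0 = 1" "fps_nth f2 0 = 1" "fps_nth f3 0 = 1" "fps_nth f6 0 = 1"
    by (simp_all add: f_def)
  note hom = fls_times_fps_to_fls fps_to_fls_power fps_to_fls_divide_unit fps_to_fls_plus
    fps_to_fls_minus fps_to_fls_uminus fps_to_fls_numeral fps_X_to_fls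
  \<comment> \<open>The identities are instantiated among Laurent series, with x the variable
    itself.\<close>
  note algebra = trisection_algebra[OF nz, of fls_X]
  show ?thesis
    unfolding f_def[symmetric] LHS fps_to_fls_eq_iff[symmetric] sections
      c0_def c1_def c2_def s0_def s1_def s2_def K_def
    using algebra
    by (simp only: hom nth fps_mult_nth_0 fps_nth_power_0 power_one mult_1_left one_neq_zero
        not_False_eq_True simp_thms)
qed

end
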